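(* Let $V$ be a topological space, let $\rho>0$, and let $G,H\colon \overline{\mathbb D}_\rho\times V\to\mathbb C$ be functions satisfying (a) $G$, $\partial G/\partial z$ and $H$ are jointly continuous on $\overline{\mathbb D}_\rho\times V$; (b) $G(\,\cdot\,,w)$ and $H(\,\cdot\,,w)$ are analytic on $\mathbb D_\rho$ for each fixed $w\in V$; and (c) $|G(z,w)|<|z|$ whenever $|z|=\rho$ and $w\in V$. Then for each $w\in V$ there exists a unique $z\in\mathbb D_\rho$ satisfying $z=G(z,w)$. Furthermore, this $z=\varphi(w)$ depends continuously on $w$ and is given explicitly by the function series $$H(\varphi(w),w)=H(0,w)+\sum_{m=1}^\infty\frac1m\,[\zeta^{m-1}]\,\frac{\partial H(\zeta,w)}{\partial\zeta}\,G(\zeta,w)^m$$ $$\phantom{H(\varphi(w),w)}=H(0,w)+\sum_{m=1}^\infty[\zeta^m]\,H(\zeta,w)\Bigl[G(\zeta,w)^m-\zeta\,\frac{\partial G(\zeta,w)}{\partial\zeta}\,G(\zeta,w)^{m-1}\Bigr],$$ which are absolutely convergent on $V$, locally uniformly on $V$. If, in addition, $V$ is an open subset of $\mathbb C^M$ and $G$ is analytic on $\mathbb D_\rho\times V$, then $\varphi$ is analytic on $V$. Finally, if $V$ is a polydisc (or more generally a complete Reinhardt domain) centered at $0\in\mathbb C^M$, and $G$ and $H$ are analytic on $\mathbb D_\rho\times V$ and satisfy $G(0,0)=0$, then $\varphi(w)$ is also given by the Taylor series $$H(\varphi(w),w)=\sum_{\alpha\in\mathbb N^M}c_\alpha\,w^\alpha,$$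 which is absolutely convergent on $V$, uniformly on compact subsets of $V$; here the coefficients $c_\alpha$ are given by the absolutely convergent sums $$c_\alpha=[w^\alpha]H(0,w)+\sum_{m=1}^\infty\frac1m\,[\zeta^{m-1}w^\alpha]\,\frac{\partial H(\zeta,w)}{\partial\zeta}\,G(\zeta,w)^m$$ $$\phantom{c_\alpha}=[w^\alpha]H(0,w)+\sum_{m=1}^\infty[\zeta^m w^\alpha]\,H(\zeta,w)\Bigl[G(\zeta,w)^m-\zeta\,\frac{\partial G(\zeta,w)}{\partial\zeta}\,G(\zeta,w)^{m-1}\Bigr].$$
   Context: For $R>0$, $\mathbb D_R=\{z\in\mathbb C:|z|<R\}$ and $\overline{\mathbb D}_R=\{z\in\mathbb C:|z|\le R\}$. The first argument of $G$ and $H$ is denoted $z$ (or $\zeta$), the second $w$. $[\zeta^n]g(\zeta)=g^{(n)}(0)/n!$ denotes the coefficient of $\zeta^n$ in the power series at $0$ of a function $g$ analytic near $0$ (here $w$ is held fixed); it applies to the whole product written to its right. Similarly, $[\zeta^n w^\alpha]$ and $[w^\alpha]$ denote coefficients in the Taylor expansion at the origin in the variables $(\zeta,w)$ or $w$, where $w^\alpha=\prod_{i=1}^M w_i^{\alpha_i}$ and $\mathbb N=\{0,1,2,\ldots\}$. "Locally uniformly on $V$" means that for each $w\in V$ there exists an open neighborhood $U\ni w$ on which the convergence is uniform. *)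

theory Defs
  imports "HOL-Complex_Analysis.Complex_Analysis"
begin

text \<open>
  The space $V$ is an abstract topology \<open>T\<close>, or, in the analytic parts, a subset of
  \<open>complex ^ 'm\<close> with its subspace topology. Functions on $\overline{D}_\rho \times V$ are
  total curried functions whose values elsewhere are irrelevant.
\<close>

text \<open>The derivative \<open>G'\<close> is taken within the closed disc, so that it also makes sense
  on the boundary circle; on the open disc it is the ordinary complex derivative.\<close>

definition lagrange_hyps ::
  "real \<Rightarrow> 'v topology \<Rightarrow> (complex \<Rightarrow> 'v \<Rightarrow> complex) \<Rightarrow> (complex \<Rightarrow> 'v \<Rightarrow> complex) \<Rightarrow> bool" where
  "lagrange_hyps \<rho> T G H \<longleftrightarrow>
     (let X = prod_topology (top_of_set (cball 0 \<rho>)) T in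
        continuous_map X euclidean (\<lambda>(z, w). G z w) \<and>
        (\<exists>G'. (\<forall>w\<in>topspace T. \<forall>z\<in>cball 0 \<rho>.
                 ((\<lambda>\<zeta>. G \<zeta> w) has_field_derivative G' z w) (at z within cball 0 \<rho>)) \<and>
              continuous_map X euclidean (\<lambda>(z, w). G' z w)) \<and>
        continuous_map X euclidean (\<lambda>(z, w). H z w)) \<and>
     (\<forall>w\<in>topspace T. (\<lambda>z. G z w) analytic_on ball 0 \<rho> \<and> (\<lambda>z. H z w) analytic_on ball 0 \<rho>) \<and>
     (\<forall>w\<in>topspace T. \<forall>z. norm z = \<rho> \<longrightarrow> norm (G z w) < norm z)"

definition fixpt :: "real \<Rightarrow> (complex \<Rightarrow> 'v \<Rightarrow> complex) \<Rightarrow> 'v \<Rightarrow> complex" where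
  "fixpt \<rho> G w = (THE z. z \<in> ball 0 \<rho> \<and> z = G z w)"

definition coeff_z :: "nat \<Rightarrow> (complex \<Rightarrow> complex) \<Rightarrow> complex" where
  "coeff_z n g = (deriv ^^ n) g 0 / fact n"

definition lagrange_fun1 ::
  "(complex \<Rightarrow> 'v \<Rightarrow> complex) \<Rightarrow> (complex \<Rightarrow> 'v \<Rightarrow> complex) \<Rightarrow> nat \<Rightarrow> complex \<Rightarrow> 'v \<Rightarrow> complex" where
  "lagrange_fun1 G H m \<zeta> w = deriv (\<lambda>z. H z w) \<zeta> * G \<zeta> w ^ m"

definition lagrange_fun2 ::
  "(complex \<Rightarrow> 'v \<Rightarrow> complex) \<Rightarrow> (complex \<Rightarrow> 'v \<Rightarrow> complex) \<Rightarrow> nat \<Rightarrow> complex \<Rightarrow> 'v \<Rightarrow> complex" where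
  "lagrange_fun2 G H m \<zeta> w =
     H \<zeta> w * (G \<zeta> w ^ m - \<zeta> * deriv (\<lambda>z. G z w) \<zeta> * G \<zeta> w ^ (m - 1))"

text \<open>Convergence of \<open>\<Sum>m\<ge>1. f m w\<close>. Uniformity is required both of the series and of the series
  of absolute values.\<close>

definition loc_unif_abs_convergent :: "'v topology \<Rightarrow> (nat \<Rightarrow> 'v \<Rightarrow> complex) \<Rightarrow> bool" where
  "loc_unif_abs_convergent T f \<longleftrightarrow>
     (\<forall>w\<in>topspace T. summable (\<lambda>k. norm (f (Suc k) w))) \<and>
     (\<forall>w\<in>topspace T. \<exists>U. openin T U \<and> w \<in> U \<and>
        uniform_limit U (\<lambda>n x. \<Sum>k<n. norm (f (Suc k) x)) (\<lambda>x. \<Sum>k. norm (f (Suc k) x))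
          sequentially \<and>
        uniform_limit U (\<lambda>n x. \<Sum>k<n. f (Suc k) x) (\<lambda>x. \<Sum>k. f (Suc k) x) sequentially)"

definition mpow :: "complex ^ 'm \<Rightarrow> ('m::finite \<Rightarrow> nat) \<Rightarrow> complex" where
  "mpow w \<alpha> = (\<Prod>i\<in>UNIV. (w $ i) ^ \<alpha> i)"

text \<open>Power series in several variables, as unordered (hence absolutely convergent) sums
  on some polydisc around the centre.\<close>

definition has_power_series_w ::
  "(complex ^ 'm \<Rightarrow> complex) \<Rightarrow> complex ^ 'm \<Rightarrow> (('m::finite \<Rightarrow> nat) \<Rightarrow> complex) \<Rightarrow> bool" where
  "has_power_series_w f b c \<longleftrightarrow>
     (\<exists>r>0. \<forall>w. (\<forall>i. norm (w $ i - b $ i) < r) \<longrightarrow>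
        ((\<lambda>\<alpha>. c \<alpha> * mpow (w - b) \<alpha>) has_sum f w) UNIV)"

definition has_power_series_zw ::
  "(complex \<Rightarrow> complex ^ 'm \<Rightarrow> complex) \<Rightarrow> complex \<Rightarrow> complex ^ 'm \<Rightarrow>
     (nat \<Rightarrow> ('m::finite \<Rightarrow> nat) \<Rightarrow> complex) \<Rightarrow> bool" where
  "has_power_series_zw f a b c \<longleftrightarrow>
     (\<exists>r>0. \<forall>z w. norm (z - a) < r \<and> (\<forall>i. norm (w $ i - b $ i) < r) \<longrightarrow>
        ((\<lambda>(n, \<alpha>). c n \<alpha> * (z - a) ^ n * mpow (w - b) \<alpha>) has_sum f z w) UNIV)"

definition analytic_w_on :: "(complex ^ 'm::finite \<Rightarrow> complex) \<Rightarrow> (complex ^ 'm) set \<Rightarrow> bool" where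
  "analytic_w_on f V \<longleftrightarrow> (\<forall>b\<in>V. \<exists>c. has_power_series_w f b c)"

definition analytic_zw_on ::
  "(complex \<Rightarrow> complex ^ 'm::finite \<Rightarrow> complex) \<Rightarrow> (complex \<times> (complex ^ 'm)) set \<Rightarrow> bool" where
  "analytic_zw_on f S \<longleftrightarrow> (\<forall>(a, b)\<in>S. \<exists>c. has_power_series_zw f a b c)"

text \<open>Taylor coefficients at the origin, meaningful for functions analytic there.\<close>

definition coeff_w :: "('m::finite \<Rightarrow> nat) \<Rightarrow> (complex ^ 'm \<Rightarrow> complex) \<Rightarrow> complex" where
  "coeff_w \<alpha> f = (THE c. has_power_series_w f 0 c) \<alpha>"

definition coeff_zw ::
  "nat \<Rightarrow> ('m::finite \<Rightarrow> nat) \<Rightarrow> (complex \<Rightarrow> complex ^ 'm \<Rightarrow> complex) \<Rightarrow> complex" where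
  "coeff_zw n \<alpha> f = (THE c. has_power_series_zw f 0 0 c) n \<alpha>"

text \<open>Connectedness is automatic, since such a set is star-shaped about 0.\<close>

definition complete_reinhardt_domain :: "(complex ^ 'm::finite) set \<Rightarrow> bool" where
  "complete_reinhardt_domain V \<longleftrightarrow>
     open V \<and> V \<noteq> {} \<and>
     (\<forall>v\<in>V. \<forall>w. (\<forall>i. norm (w $ i) \<le> norm (v $ i)) \<longrightarrow> w \<in> V)"

lemma complete_reinhardt_domain_polydisc:
  fixes r :: "'m::finite \<Rightarrow> real"
  assumes "\<And>i. r i > 0"
  shows "complete_reinhardt_domain {w :: complex ^ 'm. \<forall>i. norm (w $ i) < r i}"
proof -
  have "open {w :: complex ^ 'm. \<forall>i. norm (w $ i) < r i}"
  proof -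
    have "{w :: complex ^ 'm. \<forall>i. norm (w $ i) < r i} = (\<Inter>i. {w. norm (w $ i) < r i})"
      by auto
    then show ?thesis
      by (auto intro!: open_INT open_Collect_less continuous_intros)
  qed
  moreover have "0 \<in> {w :: complex ^ 'm. \<forall>i. norm (w $ i) < r i}"
    using assms by simp
  ultimately show ?thesis
    unfolding complete_reinhardt_domain_def by (blast intro: le_less_trans)
qed

definition unif_abs_sums_on_compacts ::
  "(complex ^ 'm::finite) set \<Rightarrow> (('m \<Rightarrow> nat) \<Rightarrow> complex ^ 'm \<Rightarrow> complex) \<Rightarrow>
     (complex ^ 'm \<Rightarrow> complex) \<Rightarrow> bool" where
  "unif_abs_sums_on_compacts V f s \<longleftrightarrow>
     (\<forall>w\<in>V. (\<lambda>\<alpha>. norm (f \<alpha> w)) summable_on UNIV \<and> ((\<lambda>\<alpha>. f \<alpha> w) has_sum s w) UNIV) \<and>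
     (\<forall>K. compact K \<and> K \<subseteq> V \<longrightarrow>
        uniform_limit K (\<lambda>F w. \<Sum>\<alpha>\<in>F. norm (f \<alpha> w)) (\<lambda>w. \<Sum>\<^sub>\<infinity>\<alpha>. norm (f \<alpha> w))
          (finite_subsets_at_top UNIV) \<and>
        uniform_limit K (\<lambda>F w. \<Sum>\<alpha>\<in>F. f \<alpha> w) s (finite_subsets_at_top UNIV))"

end

theory Submission
  imports Defs
begin

text \<open>Fix a parameter \<open>w\<close> and write \<open>g = G(\<cdot>, w)\<close>, \<open>h = H(\<cdot>, w)\<close>. By continuity the inequality
  \<open>|g(\<zeta>)| < |\<zeta>|\<close> on the boundary circle persists on an annulus \<open>r \<le> |\<zeta>| \<le> \<rho>\<close>, and Rouche's theorem,
  comparing \<open>\<zeta> - g(\<zeta>)\<close> with \<open>\<zeta>\<close>, gives exactly one zero \<open>z\<close> in the disc, a simple one. Hence the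
  weighted argument principle reads
  \<open>h(z) = (1/2\<pi>i) \<oint> h (1 - g') / (\<zeta> - g) d\<zeta>\<close> over \<open>|\<zeta>| = r\<close>. On that circle \<open>|g/\<zeta>|\<close> is bounded away
  from 1, so \<open>1 / (\<zeta> - g) = \<Sum> g\<^sup>m / \<zeta>\<^sup>m\<^sup>+\<^sup>1\<close> may be integrated term by term; the integrals are Taylor
  coefficients at 0, and this is the second form of the series. The first form has the same terms:
  compare the coefficients in \<open>(h g\<^sup>m)' = h' g\<^sup>m + m h g' g\<^sup>m\<^sup>-\<^sup>1\<close>
  (\<open>lagrange_inversion_at_fixed_point\<close>, \<open>lagrange_terms_eq\<close>).

  Everything else rests on one uniform estimate. By compactness of a circle (the tube lemma), the
  same \<open>r\<close> and the same bound \<open>|G| \<le> q r\<close> with \<open>q < 1\<close> serve all \<open>w\<close> in a neighbourhood of a given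
  point, and Cauchy's inequality then bounds the \<open>m\<close>-th term by \<open>C q\<^sup>m\<close> there
  (\<open>lagrange_terms_locally_geometric\<close>). This gives local uniform convergence over an arbitrary
  topological space. Continuity of the fixed point is again the tube lemma, applied to the
  compact set where \<open>z\<close> stays away from \<open>\<phi>(w0)\<close>.

  For holomorphic parameters the argument runs through functions that are continuous and
  holomorphic in each variable separately. This class is closed under locally uniform limits and
  under differentiation (difference quotients converge locally uniformly), so every term of the
  series belongs to it, and hence so does \<open>w \<mapsto> H(\<phi>(w), w)\<close>. Osgood's lemma
  (\<open>polydisc_power_series\<close>), proved by expanding in one coordinate after another, turns membership
  into a power series that converges on every polydisc of definition and satisfies Cauchy's
  inequalities. With \<open>H(z, w) = z\<close> this is the analyticity of \<open>\<phi>\<close>. On a complete Reinhardt domain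
  every point, and every compact set after passing to a finite cover, lies in polydiscs contained in
  the domain, and by uniqueness of coefficients all these polydiscs see the same series. Its
  coefficients are found near the origin: there the double series over \<open>m\<close> and \<open>\<alpha>\<close> is dominated by
  a product of geometric series and may be summed in either order
  (\<open>has_power_series_w_geometric_sum\<close>).\<close>


section \<open>Taylor coefficients in one variable\<close>

lemma coeff_z_cong:
  assumes "eventually (\<lambda>z. f z = g z) (nhds 0)"
  shows "coeff_z n f = coeff_z n g"
  unfolding coeff_z_def using higher_deriv_cong_ev[OF assms refl] by simp

text \<open>Uniqueness of Taylor coefficients: the tool for computing all coefficients below.\<close>

lemma coeff_z_eqI:
  assumes "r > 0" "\<And>z. norm z < r \<Longrightarrow> (\<lambda>n. a n * z ^ n) sums f z"
  shows "coeff_z n f = a n"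
proof -
  have "f has_fps_expansion Abs_fps a"
    by (rule has_fps_expansionI)
      (use assms in \<open>auto simp: eventually_nhds_metric dist_norm\<close>)
  from fps_nth_fps_expansion[OF this, of n] show ?thesis by (simp add: coeff_z_def)
qed

lemma coeff_z_sums:
  assumes "f holomorphic_on ball 0 s" "norm z < s"
  shows "(\<lambda>n. coeff_z n f * z ^ n) sums f z"
  using holomorphic_power_series[OF assms(1), of z] assms(2) by (simp add: coeff_z_def)

lemma coeff_z_diff:
  assumes "s > 0" "f holomorphic_on ball 0 s" "g holomorphic_on ball 0 s"
  shows "coeff_z n (\<lambda>z. f z - g z) = coeff_z n f - coeff_z n g"
  by (rule coeff_z_eqI[OF assms(1)])
    (auto simp: ring_distribs intro!: sums_diff coeff_z_sums[OF assms(2)] coeff_z_sums[OF assms(3)])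

lemma coeff_z_shift:
  assumes "s > 0" "f holomorphic_on ball 0 s"
  shows "coeff_z (Suc n) (\<lambda>z. z * f z) = coeff_z n f"
proof -
  have "coeff_z (Suc n) (\<lambda>z. z * f z) = (case Suc n of 0 \<Rightarrow> 0 | Suc m \<Rightarrow> coeff_z m f)"
  proof (rule coeff_z_eqI[OF assms(1)])
    fix z :: complex assume "norm z < s"
    from sums_mult[OF coeff_z_sums[OF assms(2) this], of z]
    show "(\<lambda>n. (case n of 0 \<Rightarrow> 0 | Suc m \<Rightarrow> coeff_z m f) * z ^ n) sums (z * f z)"
      by (subst sums_Suc_iff [symmetric, where f="\<lambda>n. (case n of 0 \<Rightarrow> 0 | Suc m \<Rightarrow> coeff_z m f) * z ^ n" and s="z * f z", simplified])
        (simp add: mult_ac)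
  qed
  then show ?thesis by simp
qed

lemma coeff_z_deriv: "coeff_z n (deriv f) = of_nat (Suc n) * coeff_z (Suc n) f"
  by (simp add: coeff_z_def funpow_swap1 del: of_nat_Suc)

lemma coeff_z_integral:
  assumes "f holomorphic_on ball 0 s" "0 < r" "r < s"
  shows "((\<lambda>u. f u / u ^ Suc n) has_contour_integral (2 * pi * \<i>) * coeff_z n f) (circlepath 0 r)"
  using Cauchy_has_contour_integral_higher_derivative_circlepath[of 0 r f 0 n] assms
  by (force simp: coeff_z_def intro: holomorphic_on_imp_continuous_on holomorphic_on_subset)

lemma coeff_z_bound:
  assumes "f holomorphic_on ball 0 s" "0 < r" "r < s"
    and "\<And>z. norm z = r \<Longrightarrow> norm (f z) \<le> B"
  shows "norm (coeff_z n f) \<le> B / r ^ n"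
proof -
  have "norm ((deriv ^^ n) f 0) \<le> fact n * B / r ^ n"
    by (rule Cauchy_inequality)
      (use assms in \<open>auto intro!: holomorphic_on_imp_continuous_on intro: holomorphic_on_subset\<close>)
  then show ?thesis by (simp add: coeff_z_def norm_divide field_simps)
qed

text \<open>Cauchy's inequality with a bound known only on the open disc: let the radius in
  \<open>coeff_z_bound\<close> tend to \<open>s\<close>. Keeping the full radius matters for the induction over the
  coordinates of a polydisc, where the bounds of successive coordinates are multiplied.\<close>

lemma coeff_z_bound_open:
  assumes f: "f holomorphic_on ball 0 s" and s: "s > 0" and B: "\<And>z. norm z < s \<Longrightarrow> norm (f z) \<le> B"
  shows "norm (coeff_z n f) \<le> B / s ^ n"
proof -
  have "norm (coeff_z n f) * s ^ n \<le> B"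
  proof (rule tendsto_upperbound)
    show "((\<lambda>r. norm (coeff_z n f) * r ^ n) \<longlongrightarrow> norm (coeff_z n f) * s ^ n) (at_left s)"
      by (intro tendsto_intros)
    have "\<forall>\<^sub>F r in at_left s. r \<in> {0<..<s}" using s by (intro eventually_at_left_real)
    then show "\<forall>\<^sub>F r in at_left s. norm (coeff_z n f) * r ^ n \<le> B"
    proof eventually_elim
      case (elim r)
      then have "norm (coeff_z n f) \<le> B / r ^ n"
        using B by (intro coeff_z_bound[OF f]) auto
      then show ?case using elim by (simp add: field_simps)
    qed
  qed auto
  then show ?thesis using s by (simp add: field_simps)
qed


section \<open>Lagrange inversion at a fixed point\<close>

text \<open>The points of the closed disc where the inequality fails form a compact set that avoids the
  boundary circle, so their moduli have a maximum below \<open>\<rho>\<close>. This moves the argument to a circle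
  inside the open disc, where the functions are holomorphic.\<close>

lemma annulus_norm_less:
  fixes g :: "complex \<Rightarrow> complex"
  assumes cont: "continuous_on (cball 0 \<rho>) g" and "\<rho> > 0"
    and bd: "\<And>z. norm z = \<rho> \<Longrightarrow> norm (g z) < norm z"
  obtains r where "0 < r" "r < \<rho>" "\<And>z. r \<le> norm z \<Longrightarrow> norm z \<le> \<rho> \<Longrightarrow> norm (g z) < norm z"
proof -
  define K where "K = {z \<in> cball 0 \<rho>. norm z \<le> norm (g z)}"
  have "closedin (top_of_set (cball 0 \<rho>)) K"
    unfolding K_def
    by (intro continuous_closedin_preimage_constant[where f="\<lambda>z. max 0 (norm z - norm (g z))" and a=0, THEN back_subst[of "closedin _"]] continuous_intros cont) (auto simp: max_def)
  then have "compact K"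
    by (rule closedin_compact[OF compact_cball])
  show thesis
  proof (cases "K = {}")
    case True
    show ?thesis
    proof (rule that[of "\<rho>/2"])
      fix z :: complex assume "norm z \<le> \<rho>"
      then have "z \<notin> K" "z \<in> cball 0 \<rho>" using True by auto
      then show "norm (g z) < norm z" by (auto simp: K_def)
    qed (use \<open>\<rho> > 0\<close> in auto)
  next
    case False
    obtain k where k: "k \<in> K" "\<And>z. z \<in> K \<Longrightarrow> norm z \<le> norm k"
      using continuous_attains_sup[OF \<open>compact K\<close> False continuous_on_norm_id] by auto
    have "norm k < \<rho>"
      using k(1) bd[of k] by (force simp: K_def)
    show ?thesis
    proof (rule that[of "(norm k + \<rho>)/2"])
      fix z :: complex assume "(norm k + \<rho>) / 2 \<le> norm z" "norm z \<le> \<rho>"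
      then show "norm (g z) < norm z"
        using k(2)[of z] \<open>norm k < \<rho>\<close> by (force simp: K_def not_le)
    next
      show "0 < (norm k + \<rho>)/2" using \<open>\<rho> > 0\<close> by (intro divide_pos_pos add_nonneg_pos) auto
    qed (use \<open>norm k < \<rho>\<close> in auto)
  qed
qed

text \<open>Rouche's theorem on the circle of radius \<open>r\<close>: the zeros of \<open>\<zeta> - g(\<zeta>)\<close>, counted with multiplicity,
  are as many as those of \<open>\<zeta>\<close>, namely one. The inequality on the whole annulus keeps further zeros
  out of the larger disc.\<close>

lemma unique_simple_fixed_point:
  fixes g :: "complex \<Rightarrow> complex"
  assumes r: "0 < r" "r < s" and g: "g holomorphic_on ball 0 s"
    and less: "\<And>z. r \<le> norm z \<Longrightarrow> norm z < s \<Longrightarrow> norm (g z) < norm z"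
  obtains z where "norm z < r" "{\<zeta> \<in> ball 0 s. \<zeta> - g \<zeta> = 0} = {z}" "zorder (\<lambda>\<zeta>. \<zeta> - g \<zeta>) z = 1"
proof -
  define Z where "Z = {\<zeta> \<in> ball 0 s. \<zeta> - g \<zeta> = 0}"
  have Zr: "norm z < r" if "z \<in> Z" for z
    using less[of z] that by (force simp: Z_def)
  have hol: "(\<lambda>\<zeta>. \<zeta> - g \<zeta>) holomorphic_on ball 0 s"
    by (intro holomorphic_intros g)
  have nz_r: "of_real r - g (of_real r) \<noteq> 0"
    using less[of "of_real r"] r by force
  have nonconst: "\<not> (\<lambda>\<zeta>. \<zeta> - g \<zeta>) constant_on ball 0 s"
    if "z \<in> Z" for z
  proof
    assume "(\<lambda>\<zeta>. \<zeta> - g \<zeta>) constant_on ball 0 s"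
    moreover have "of_real r \<in> ball (0::complex) s" "z \<in> ball 0 s" using r that by (auto simp: Z_def)
    ultimately show False using nz_r that unfolding constant_on_def Z_def by force
  qed
  have finZ: "finite Z"
  proof (cases "Z = {}")
    case False
    then obtain z where "z \<in> Z" by auto
    have "finite {\<zeta> \<in> cball 0 r. \<zeta> - g \<zeta> = 0}"
      by (rule holomorphic_compact_finite_zeros[OF hol]) (use nonconst[OF \<open>z \<in> Z\<close>] r in auto)
    then show ?thesis
      by (rule rev_finite_subset) (use Zr in \<open>fastforce simp: Z_def\<close>)
  qed auto
  have wn: "winding_number (circlepath 0 r) z = 1" if "z \<in> Z" for z
    using winding_number_circlepath[of z 0 r] Zr[OF that] by simp
  have zpos: "zorder (\<lambda>\<zeta>. \<zeta> - g \<zeta>) z > 0" if "z \<in> Z" for z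
  proof -
    have "eventually (\<lambda>x. x - g x \<noteq> 0) (at z)"
      using non_zero_neighbour_alt[OF hol, of z "of_real r"] nz_r r that
      by (auto simp: Z_def elim: eventually_mono)
    then have "\<exists>\<^sub>F \<zeta> in at z. \<zeta> - g \<zeta> \<noteq> 0"
      by (simp add: eventually_frequently)
    from zorder_pos_iff[OF hol _ _ this] show ?thesis
      using that by (auto simp: Z_def)
  qed
  have zid: "{p \<in> ball 0 s. p = (0::complex)} = {0}" using r by auto
  have Rouche: "(\<Sum>p\<in>{p \<in> ball 0 s. p + - g p = 0}. winding_number (circlepath 0 r) p * zorder (\<lambda>p. p + - g p) p)
      = (\<Sum>p\<in>{p \<in> ball 0 s. p = 0}. winding_number (circlepath 0 r) p * zorder (\<lambda>p. p) p)"
  proof (rule Rouche_theorem)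
    show "finite {p \<in> ball 0 s. p + - g p = 0}" using finZ by (simp add: Z_def)
    show "(\<lambda>z. - g z) holomorphic_on ball 0 s" by (intro holomorphic_intros g)
    show "\<forall>z\<in>path_image (circlepath 0 r). cmod (- g z) < cmod z"
      using less r by auto
    show "\<forall>z. z \<notin> ball 0 s \<longrightarrow> winding_number (circlepath 0 r) z = 0"
    proof (intro allI impI)
      fix z :: complex assume "z \<notin> ball 0 s"
      then show "winding_number (circlepath 0 r) z = 0"
        using r by (intro winding_number_zero_outside[of _ "cball 0 r"]) auto
    qed
  qed (use r in \<open>auto simp: zid\<close>)
  have "zorder (\<lambda>p::complex. p) 0 = 1"
    by (rule zorder_eqI[of UNIV _ "\<lambda>_. 1"]) auto
  with Rouche[unfolded add_uminus_conv_diff, folded Z_def] have "(\<Sum>p\<in>Z. complex_of_int (zorder (\<lambda>\<zeta>. \<zeta> - g \<zeta>) p)) = 1"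
    unfolding zid using r by (simp add: Z_def[symmetric] winding_number_circlepath_centre wn del: mem_ball right_minus_eq cong: sum.cong)
  then have sum1: "(\<Sum>p\<in>Z. zorder (\<lambda>\<zeta>. \<zeta> - g \<zeta>) p) = 1"
    by (metis of_int_eq_1_iff of_int_sum)
  \<comment> \<open>Every zero has positive order and the orders add up to 1, so there is one zero, of order 1.\<close>
  have "(\<Sum>p\<in>Z. (1::int)) \<le> (\<Sum>p\<in>Z. zorder (\<lambda>\<zeta>. \<zeta> - g \<zeta>) p)"
    using zpos by (intro sum_mono) force
  then have "card Z \<le> 1" using sum1 by simp
  moreover have "Z \<noteq> {}" using sum1 by auto
  ultimately have "card Z = 1" using finZ by (simp add: Suc_leI card_gt_0_iff le_antisym)
  then obtain z where z: "Z = {z}" by (auto simp: card_1_singleton_iff)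
  show thesis
    by (rule that[of z]) (use Zr[of z] z sum1 in \<open>auto simp: Z_def\<close>)
qed

text \<open>Expand \<open>1 / (\<zeta> - g) = \<Sum> g\<^sup>m / \<zeta>\<^sup>m\<^sup>+\<^sup>1\<close> on the circle, where the series converges uniformly because
  \<open>|g|\<close> attains a maximum smaller than \<open>r\<close>; the \<open>m\<close>-th integral is Cauchy's formula for the coefficient.\<close>

lemma coeff_power_sums_contour_integral:
  assumes r: "0 < r" "r < s" and g: "g holomorphic_on ball 0 s" and u: "u holomorphic_on ball 0 s"
    and less: "\<And>z. norm z = r \<Longrightarrow> norm (g z) < r"
  shows "(\<lambda>m. 2 * pi * \<i> * coeff_z m (\<lambda>\<zeta>. u \<zeta> * g \<zeta> ^ m)) sums
           contour_integral (circlepath 0 r) (\<lambda>\<zeta>. u \<zeta> / (\<zeta> - g \<zeta>))"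
proof -
  have sub: "sphere 0 r \<subseteq> ball (0::complex) s" using r by auto
  have cg: "continuous_on (sphere 0 r) g" and cu: "continuous_on (sphere 0 r) u"
    using g u sub by (auto intro: holomorphic_on_imp_continuous_on holomorphic_on_subset)
  have ne: "sphere (0::complex) r \<noteq> {}" using r by simp
  obtain x where x: "norm x = r" "\<And>y. norm y = r \<Longrightarrow> norm (g y) \<le> norm (g x)"
    using continuous_attains_sup[OF compact_sphere ne continuous_on_norm[OF cg]] by auto
  define q where "q = norm (g x) / r"
  have q: "0 \<le> q" "q < 1" using less[OF x(1)] r by (auto simp: q_def)
  have gq: "norm (g y) \<le> q * r" if "norm y = r" for y using x(2)[OF that] r by (simp add: q_def)
  obtain B where B: "\<And>y. norm y = r \<Longrightarrow> norm (u y) \<le> B"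
    using continuous_attains_sup[OF compact_sphere ne continuous_on_norm[OF cu]] by (metis dist_0_norm mem_sphere)
  let ?F = "\<lambda>m \<zeta>. (u \<zeta> * g \<zeta> ^ m) / \<zeta> ^ Suc m"
  have int: "(?F m has_contour_integral 2 * pi * \<i> * coeff_z m (\<lambda>\<zeta>. u \<zeta> * g \<zeta> ^ m)) (circlepath 0 r)" for m
    using r by (intro coeff_z_integral[where s=s] holomorphic_intros g u) auto
  have Feq: "?F m \<zeta> = (u \<zeta> / \<zeta>) * (g \<zeta> / \<zeta>) ^ m" for m \<zeta>
    by (simp add: power_divide)
  have U: "uniform_limit (sphere 0 r) (\<lambda>n \<zeta>. \<Sum>m<n. ?F m \<zeta>) (\<lambda>\<zeta>. \<Sum>m. ?F m \<zeta>) sequentially"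
  proof (rule Weierstrass_m_test)
    show "summable (\<lambda>m. B / r * q ^ m)" using q by (intro summable_mult summable_geometric) auto
    fix m and \<zeta> :: complex assume "\<zeta> \<in> sphere 0 r"
    then have \<zeta>: "norm \<zeta> = r" by simp
    show "norm (?F m \<zeta>) \<le> B / r * q ^ m"
      unfolding Feq norm_mult norm_divide norm_power
      using \<zeta> r gq[OF \<zeta>] B[OF \<zeta>] q by (intro mult_mono power_mono divide_right_mono) (auto simp: field_simps intro: order_trans[OF norm_ge_zero])
  qed
  have E: "(\<Sum>m. ?F m \<zeta>) = u \<zeta> / (\<zeta> - g \<zeta>)" if "\<zeta> \<in> sphere 0 r" for \<zeta>
  proof -
    have "\<zeta> \<noteq> 0" using that r by auto
    moreover have "norm (g \<zeta> / \<zeta>) < 1" using that r less[of \<zeta>] by (simp add: norm_divide)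
    then have "(\<lambda>m. (u \<zeta> / \<zeta>) * (g \<zeta> / \<zeta>) ^ m) sums ((u \<zeta> / \<zeta>) * (1 / (1 - g \<zeta> / \<zeta>)))"
      by (intro sums_mult geometric_sums)
    ultimately show ?thesis unfolding Feq by (subst sums_unique[symmetric]) (auto simp: field_simps)
  qed
  have "uniform_limit (sphere 0 r) (\<lambda>n \<zeta>. \<Sum>m<n. ?F m \<zeta>) (\<lambda>\<zeta>. u \<zeta> / (\<zeta> - g \<zeta>)) sequentially"
    by (rule iffD1[OF uniform_limit_cong'[OF refl E] U])
  moreover have partial: "((\<lambda>\<zeta>. \<Sum>m<n. ?F m \<zeta>) has_contour_integral (\<Sum>m<n. 2 * pi * \<i> * coeff_z m (\<lambda>\<zeta>. u \<zeta> * g \<zeta> ^ m)))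
      (circlepath 0 r)" for n
    by (intro has_contour_integral_sum int) auto
  ultimately have "(\<lambda>n. contour_integral (circlepath 0 r) (\<lambda>\<zeta>. \<Sum>m<n. ?F m \<zeta>)) \<longlonglongrightarrow>
      contour_integral (circlepath 0 r) (\<lambda>\<zeta>. u \<zeta> / (\<zeta> - g \<zeta>))"
    by (intro contour_integral_uniform_limit_circlepath(2) always_eventually allI has_contour_integral_integrable[OF partial])
      (use r in auto)
  then show ?thesis unfolding contour_integral_unique[OF partial] sums_def .
qed

text \<open>The integrand \<open>h (1 - g') / (\<zeta> - g)\<close> is the logarithmic derivative of \<open>\<zeta> - g\<close> weighted by \<open>h\<close>. Its
  integral is \<open>2\<pi>i h(z)\<close> by the argument principle; on the other side the two summands \<open>h\<close> and
  \<open>h g'\<close> are expanded separately. The shift of the index between the two coefficients is the one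
  between \<open>g\<^sup>m\<close> and \<open>\<zeta> g' g\<^sup>m\<^sup>-\<^sup>1\<close> in the second Lagrange series.\<close>

theorem lagrange_inversion_at_fixed_point:
  fixes g h :: "complex \<Rightarrow> complex"
  assumes r: "0 < r" "r < s" and g: "g holomorphic_on ball 0 s" and h: "h holomorphic_on ball 0 s"
    and less: "\<And>z. r \<le> norm z \<Longrightarrow> norm z < s \<Longrightarrow> norm (g z) < norm z"
    and z: "norm z < s" "z = g z"
  shows "(\<lambda>k. coeff_z (Suc k) (\<lambda>\<zeta>. h \<zeta> * g \<zeta> ^ Suc k) - coeff_z k (\<lambda>\<zeta>. h \<zeta> * deriv g \<zeta> * g \<zeta> ^ k))
           sums (h z - h 0)"
proof -
  obtain z' where z': "norm z' < r" "{\<zeta> \<in> ball 0 s. \<zeta> - g \<zeta> = 0} = {z'}" "zorder (\<lambda>\<zeta>. \<zeta> - g \<zeta>) z' = 1"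
    using unique_simple_fixed_point[OF r g less] by blast
  have "z' = z" using z z'(2) by force
  have hg': "(\<lambda>\<zeta>. h \<zeta> * deriv g \<zeta>) holomorphic_on ball 0 s"
    by (intro holomorphic_intros holomorphic_deriv g h) auto
  let ?C = "\<lambda>f. contour_integral (circlepath 0 r) f"
  have lr: "norm (g z) < r" if "norm z = r" for z using less[of z] that r by auto
  note S1 = coeff_power_sums_contour_integral[OF r g h lr]
    and S2 = coeff_power_sums_contour_integral[OF r g hg' lr]
  have hol: "(\<lambda>\<zeta>. \<zeta> - g \<zeta>) holomorphic_on ball 0 s"
    by (intro holomorphic_intros g)
  have pz: "{w \<in> ball 0 s. w - g w = 0 \<or> w \<in> {}} = {z}" using z' \<open>z' = z\<close> by simp
  have arg: "?C (\<lambda>x. deriv (\<lambda>\<zeta>. \<zeta> - g \<zeta>) x * h x / (x - g x)) = 2 * pi * \<i> *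
      (\<Sum>p\<in>{w \<in> ball 0 s. w - g w = 0 \<or> w \<in> {}}. winding_number (circlepath 0 r) p * h p * zorder (\<lambda>\<zeta>. \<zeta> - g \<zeta>) p)"
  proof (rule argument_principle)
    show "\<forall>z. z \<notin> ball 0 s \<longrightarrow> winding_number (circlepath 0 r) z = 0"
    proof (intro allI impI)
      fix z :: complex assume "z \<notin> ball 0 s"
      then show "winding_number (circlepath 0 r) z = 0"
        using r by (intro winding_number_zero_outside[of _ "cball 0 r"]) auto
    qed
  next
    show "path_image (circlepath 0 r) \<subseteq> ball 0 s - {w \<in> ball 0 s. w - g w = 0 \<or> w \<in> {}}"
      unfolding pz using r z' \<open>z' = z\<close> by auto
  qed (use hol h pz in auto)
  also have "\<dots> = 2 * pi * \<i> * h z"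
    unfolding pz using winding_number_circlepath[of z 0 r] z' \<open>z' = z\<close> by simp
  finally have arg': "?C (\<lambda>x. deriv (\<lambda>\<zeta>. \<zeta> - g \<zeta>) x * h x / (x - g x)) = 2 * pi * \<i> * h z" .
  have nz: "x - g x \<noteq> 0" if "norm x = r" for x using lr[OF that] that by force
  have I: "(\<lambda>x. u x / (x - g x)) contour_integrable_on circlepath 0 r" if "u holomorphic_on ball 0 s" for u
    using r that nz by (intro contour_integrable_continuous_circlepath continuous_intros)
      (auto intro!: holomorphic_on_imp_continuous_on intro: holomorphic_on_subset g)
  have "?C (\<lambda>x. deriv (\<lambda>\<zeta>. \<zeta> - g \<zeta>) x * h x / (x - g x)) = ?C (\<lambda>x. h x / (x - g x) - h x * deriv g x / (x - g x))"
  proof (rule contour_integral_eq)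
    fix x assume "x \<in> path_image (circlepath 0 r)"
    then have "x \<in> ball 0 s" using r by auto
    then have "deriv (\<lambda>\<zeta>. \<zeta> - g \<zeta>) x = 1 - deriv g x"
      using g holomorphic_on_imp_differentiable_at[OF g] by (subst deriv_diff) (auto simp del: eq_diff_eq diff_eq_eq)
    then show "deriv (\<lambda>\<zeta>. \<zeta> - g \<zeta>) x * h x / (x - g x) = h x / (x - g x) - h x * deriv g x / (x - g x)"
      by (simp only: ring_distribs diff_divide_distrib mult_1 mult.commute)
  qed
  also have "\<dots> = ?C (\<lambda>x. h x / (x - g x)) - ?C (\<lambda>x. h x * deriv g x / (x - g x))"
    by (intro contour_integral_diff I h hg')
  finally have diff: "?C (\<lambda>x. h x / (x - g x)) - ?C (\<lambda>x. h x * deriv g x / (x - g x)) = 2 * pi * \<i> * h z"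
    using arg' by simp
  have "coeff_z 0 (\<lambda>\<zeta>. h \<zeta> * g \<zeta> ^ 0) = h 0" by (simp add: coeff_z_def)
  with S1 have "(\<lambda>k. 2 * pi * \<i> * coeff_z (Suc k) (\<lambda>\<zeta>. h \<zeta> * g \<zeta> ^ Suc k)) sums (?C (\<lambda>x. h x / (x - g x)) - 2 * pi * \<i> * h 0)"
    by (subst sums_Suc_iff) simp
  from sums_diff[OF this S2] have "(\<lambda>k. 2 * pi * \<i> * coeff_z (Suc k) (\<lambda>\<zeta>. h \<zeta> * g \<zeta> ^ Suc k) - 2 * pi * \<i> * coeff_z k (\<lambda>\<zeta>. h \<zeta> * deriv g \<zeta> * g \<zeta> ^ k))
     sums (?C (\<lambda>x. h x / (x - g x)) - ?C (\<lambda>x. h x * deriv g x / (x - g x)) - 2 * pi * \<i> * h 0)"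
    by (simp add: algebra_simps)
  from sums_divide[OF this, of "2 * pi * \<i>"] show ?thesis
    unfolding diff by (simp add: diff_divide_distrib)
qed

lemma coeff_z_lagrange_fun2:
  assumes "s > 0" "(\<lambda>z. G z w) holomorphic_on ball 0 s" "(\<lambda>z. H z w) holomorphic_on ball 0 s"
  shows "coeff_z (Suc k) (\<lambda>\<zeta>. lagrange_fun2 G H (Suc k) \<zeta> w)
    = coeff_z (Suc k) (\<lambda>\<zeta>. H \<zeta> w * G \<zeta> w ^ Suc k) - coeff_z k (\<lambda>\<zeta>. H \<zeta> w * deriv (\<lambda>z. G z w) \<zeta> * G \<zeta> w ^ k)"
proof -
  have g': "(\<lambda>\<zeta>. deriv (\<lambda>z. G z w) \<zeta>) holomorphic_on ball 0 s"
    using assms by (intro holomorphic_deriv) auto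
  have "coeff_z (Suc k) (\<lambda>\<zeta>. lagrange_fun2 G H (Suc k) \<zeta> w)
     = coeff_z (Suc k) (\<lambda>\<zeta>. H \<zeta> w * G \<zeta> w ^ Suc k - \<zeta> * (H \<zeta> w * deriv (\<lambda>z. G z w) \<zeta> * G \<zeta> w ^ k))"
    by (simp add: lagrange_fun2_def algebra_simps)
  also have "\<dots> = coeff_z (Suc k) (\<lambda>\<zeta>. H \<zeta> w * G \<zeta> w ^ Suc k) - coeff_z (Suc k) (\<lambda>\<zeta>. \<zeta> * (H \<zeta> w * deriv (\<lambda>z. G z w) \<zeta> * G \<zeta> w ^ k))"
    using assms g' by (intro coeff_z_diff[of s] holomorphic_intros) auto
  also have "coeff_z (Suc k) (\<lambda>\<zeta>. \<zeta> * (H \<zeta> w * deriv (\<lambda>z. G z w) \<zeta> * G \<zeta> w ^ k)) = coeff_z k (\<lambda>\<zeta>. H \<zeta> w * deriv (\<lambda>z. G z w) \<zeta> * G \<zeta> w ^ k)"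
    using assms g' by (intro coeff_z_shift[of s] holomorphic_intros) auto
  finally show ?thesis .
qed

text \<open>The two Lagrange series agree term by term: differentiate \<open>h g\<^sup>k\<^sup>+\<^sup>1\<close> by the product rule and compare
  coefficients of \<open>\<zeta>\<^sup>k\<close>. Hence estimates for one of the two series serve both.\<close>

lemma lagrange_terms_eq:
  assumes s: "s > 0" and g: "(\<lambda>z. G z w) holomorphic_on ball 0 s" and h: "(\<lambda>z. H z w) holomorphic_on ball 0 s"
  shows "1 / of_nat (Suc k) * coeff_z k (\<lambda>\<zeta>. lagrange_fun1 G H (Suc k) \<zeta> w)
    = coeff_z (Suc k) (\<lambda>\<zeta>. lagrange_fun2 G H (Suc k) \<zeta> w)"
proof -
  let ?g = "\<lambda>z. G z w" and ?h = "\<lambda>z. H z w"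
  have g': "deriv ?g holomorphic_on ball 0 s" and h': "deriv ?h holomorphic_on ball 0 s"
    using assms by (auto intro!: holomorphic_deriv)
  have "of_nat (Suc k) * coeff_z (Suc k) (\<lambda>\<zeta>. H \<zeta> w * G \<zeta> w ^ Suc k) = coeff_z k (deriv (\<lambda>\<zeta>. H \<zeta> w * G \<zeta> w ^ Suc k))"
    by (simp add: coeff_z_deriv)
  \<comment> \<open>The sum from the product rule is written as a difference, the form that \<open>coeff_z_diff\<close> splits.\<close>
  also have "\<dots> = coeff_z k (\<lambda>\<zeta>. lagrange_fun1 G H (Suc k) \<zeta> w - - of_nat (Suc k) * (H \<zeta> w * deriv ?g \<zeta> * G \<zeta> w ^ k))"
  proof (rule coeff_z_cong, rule eventually_nhds_in_open[of "ball 0 s", THEN eventually_mono])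
    fix \<zeta> :: complex assume \<zeta>: "\<zeta> \<in> ball 0 s"
    have "(?g has_field_derivative deriv ?g \<zeta>) (at \<zeta>)" "(?h has_field_derivative deriv ?h \<zeta>) (at \<zeta>)"
      using \<zeta> g h by (auto intro!: holomorphic_derivI)
    then have "((\<lambda>\<zeta>. H \<zeta> w * G \<zeta> w ^ Suc k) has_field_derivative
       (lagrange_fun1 G H (Suc k) \<zeta> w - - of_nat (Suc k) * (H \<zeta> w * deriv ?g \<zeta> * G \<zeta> w ^ k))) (at \<zeta>)"
      by (auto intro!: derivative_eq_intros simp: lagrange_fun1_def algebra_simps simp del: power_Suc)
    then show "deriv (\<lambda>\<zeta>. H \<zeta> w * G \<zeta> w ^ Suc k) \<zeta> = lagrange_fun1 G H (Suc k) \<zeta> w - - of_nat (Suc k) * (H \<zeta> w * deriv ?g \<zeta> * G \<zeta> w ^ k)"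
      by (rule DERIV_imp_deriv)
  qed (use s in auto)
  also have "\<dots> = coeff_z k (\<lambda>\<zeta>. lagrange_fun1 G H (Suc k) \<zeta> w) - coeff_z k (\<lambda>\<zeta>. - of_nat (Suc k) * (H \<zeta> w * deriv ?g \<zeta> * G \<zeta> w ^ k))"
    unfolding lagrange_fun1_def using s g h g' h'
    by (intro coeff_z_diff[of s] holomorphic_intros) auto
  also have "coeff_z k (\<lambda>\<zeta>. - of_nat (Suc k) * (H \<zeta> w * deriv ?g \<zeta> * G \<zeta> w ^ k)) = - of_nat (Suc k) * coeff_z k (\<lambda>\<zeta>. H \<zeta> w * deriv ?g \<zeta> * G \<zeta> w ^ k)"
  proof (rule coeff_z_eqI[OF s, where a="\<lambda>n. - of_nat (Suc k) * coeff_z n (\<lambda>\<zeta>. H \<zeta> w * deriv ?g \<zeta> * G \<zeta> w ^ k)"])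
    fix z :: complex assume "norm z < s"
    from sums_mult[OF coeff_z_sums[OF _ this, of "\<lambda>\<zeta>. H \<zeta> w * deriv ?g \<zeta> * G \<zeta> w ^ k"], of "- of_nat (Suc k)"]
    show "(\<lambda>n. - of_nat (Suc k) * coeff_z n (\<lambda>\<zeta>. H \<zeta> w * deriv ?g \<zeta> * G \<zeta> w ^ k) * z ^ n) sums
         (- of_nat (Suc k) * (H z w * deriv ?g z * G z w ^ k))"
      unfolding mult.assoc using g h g' by (simp add: holomorphic_intros del: of_nat_Suc)
  qed
  finally show ?thesis
    unfolding coeff_z_lagrange_fun2[of s G w H k, OF assms] by (simp add: field_simps del: of_nat_Suc)
qed


section \<open>Continuous parameters\<close>

text \<open>The tube lemma in the form in which compactness is used here: an open condition on \<open>F z w\<close> that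
  holds for all \<open>z\<close> in a compact set at \<open>w0\<close> holds for all these \<open>z\<close> at all nearby \<open>w\<close>.\<close>

lemma eventually_in_open_uniformly_on_compact:
  fixes F :: "complex \<Rightarrow> 'v \<Rightarrow> 'b::topological_space"
  assumes F: "continuous_map (prod_topology (top_of_set K) T) euclidean (\<lambda>(z, w). F z w)"
    and C: "compact C" "C \<subseteq> K" and w0: "w0 \<in> topspace T" and S: "open S" "\<And>z. z \<in> C \<Longrightarrow> F z w0 \<in> S"
  obtains U where "openin T U" "w0 \<in> U" "\<And>z w. z \<in> C \<Longrightarrow> w \<in> U \<Longrightarrow> F z w \<in> S"
proof -
  let ?X = "prod_topology (top_of_set K) T"
  have "openin ?X {p \<in> topspace ?X. (\<lambda>(z, w). F z w) p \<in> S}"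
    using F S(1) by (intro openin_continuous_map_preimage) auto
  moreover have "compactin (top_of_set K) C" using C by (simp add: compactin_subtopology)
  moreover have "C \<times> {w0} \<subseteq> {p \<in> topspace ?X. (\<lambda>(z, w). F z w) p \<in> S}"
    using C w0 S(2) by auto
  ultimately have "\<exists>U V. openin (top_of_set K) U \<and> openin T V \<and> C \<subseteq> U \<and> w0 \<in> V \<and>
      U \<times> V \<subseteq> {p \<in> topspace ?X. (\<lambda>(z, w). F z w) p \<in> S}"
    using w0 by (intro tube_lemma_left)
  then obtain U V where "openin T V" "C \<subseteq> U" "w0 \<in> V"
      and UV: "U \<times> V \<subseteq> {p \<in> topspace ?X. (\<lambda>(z, w). F z w) p \<in> S}"
    by blast
  show thesis
  proof (rule that[of V])
    fix z w assume "z \<in> C" "w \<in> V"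
    then have "(z, w) \<in> U \<times> V" using \<open>C \<subseteq> U\<close> by auto
    then show "F z w \<in> S" using UV by auto
  qed fact+
qed

context
  fixes \<rho> :: real and T :: "'v topology" and G H :: "complex \<Rightarrow> 'v \<Rightarrow> complex"
  assumes hyps: "lagrange_hyps \<rho> T G H" and \<rho>: "\<rho> > 0"
begin

private lemma cont_G: "continuous_map (prod_topology (top_of_set (cball 0 \<rho>)) T) euclidean (\<lambda>(z, w). G z w)"
  and cont_H: "continuous_map (prod_topology (top_of_set (cball 0 \<rho>)) T) euclidean (\<lambda>(z, w). H z w)"
  using hyps by (auto simp: lagrange_hyps_def Let_def)

private lemma slice:
  assumes "w \<in> topspace T" 
  shows "(\<lambda>z. G z w) holomorphic_on ball 0 \<rho>" "(\<lambda>z. H z w) holomorphic_on ball 0 \<rho>"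
    and "norm z = \<rho> \<Longrightarrow> norm (G z w) < norm z"
  using hyps assms by (auto simp: lagrange_hyps_def Let_def analytic_imp_holomorphic)

private lemma cont_slice:
  assumes "continuous_map (prod_topology (top_of_set K) T) euclidean (\<lambda>(z, w). F z w)" "w \<in> topspace T" 
  shows "continuous_on K (\<lambda>z. F z w)"
proof -
  have "continuous_map (top_of_set K) (prod_topology (top_of_set K) T) (\<lambda>z. (z, w))"
    using assms(2) by (simp add: continuous_map_pairedI)
  from continuous_map_compose[OF this assms(1)] show ?thesis by (simp add: o_def)
qed

lemma lagrange_hyps_annulus:
  assumes "w \<in> topspace T"
  obtains r where "0 < r" "r < \<rho>" "\<And>z. r \<le> norm z \<Longrightarrow> norm z < \<rho> \<Longrightarrow> norm (G z w) < norm z"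
proof (rule annulus_norm_less[OF cont_slice[OF cont_G assms] \<rho> slice(3)[OF assms]])
  fix r assume "0 < r" "r < \<rho>" "\<And>z. r \<le> norm z \<Longrightarrow> norm z \<le> \<rho> \<Longrightarrow> norm (G z w) < norm z"
  then show thesis by (intro that[of r]) auto
qed

lemma lagrange_fixpt_ex1:
  assumes "w \<in> topspace T"
  shows "\<exists>!z. z \<in> ball 0 \<rho> \<and> z = G z w"
proof -
  obtain r where r: "0 < r" "r < \<rho>" "\<And>z. r \<le> norm z \<Longrightarrow> norm z < \<rho> \<Longrightarrow> norm (G z w) < norm z"
    using lagrange_hyps_annulus[OF assms] by blast
  obtain z where "{\<zeta> \<in> ball 0 \<rho>. \<zeta> - G \<zeta> w = 0} = {z}"
    using unique_simple_fixed_point[OF r(1,2) slice(1)[OF assms] r(3)] by blast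
  then show ?thesis by (intro ex1I[of _ z]) auto
qed

lemma fixpt_in_ball_and_fixed:
  assumes "w \<in> topspace T"
  shows "norm (fixpt \<rho> G w) < \<rho>" "G (fixpt \<rho> G w) w = fixpt \<rho> G w"
  using theI'[OF lagrange_fixpt_ex1[OF assms]] by (auto simp: fixpt_def)

lemma fixpt_eqI:
  assumes "w \<in> topspace T" "z \<in> ball 0 \<rho> \<and> z = G z w"
  shows "z = fixpt \<rho> G w"
  unfolding fixpt_def using the1_equality[OF lagrange_fixpt_ex1[OF assms(1)] assms(2)] by simp

text \<open>Let \<open>S\<close> be a neighbourhood of \<open>\<phi>(w0)\<close>. On the compact set of points of the closed disc outside
  \<open>S\<close> the function \<open>z - G z w0\<close> has no zero, so by the tube lemma neither has \<open>z - G z w\<close> for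
  nearby \<open>w\<close>; the fixed point must then lie in \<open>S\<close>.\<close>

lemma continuous_map_fixpt: "continuous_map T euclidean (fixpt \<rho> G)"
  unfolding continuous_map
proof (intro conjI allI impI)
  fix S :: "complex set" assume "openin euclidean S"
  then have S: "open S" by simp
  show "openin T {w \<in> topspace T. fixpt \<rho> G w \<in> S}"
  proof (subst openin_subopen, intro ballI)
    fix w0 assume "w0 \<in> {w \<in> topspace T. fixpt \<rho> G w \<in> S}"
    then have w0: "w0 \<in> topspace T" "fixpt \<rho> G w0 \<in> S" by auto
    have diff: "continuous_map (prod_topology (top_of_set (cball 0 \<rho>)) T) euclidean (\<lambda>(z, w). z - G z w)"
      using continuous_map_diff[OF continuous_map_into_fulltopology[OF continuous_map_fst] cont_G]
      by (simp add: case_prod_unfold)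
    have nz: "z - G z w0 \<noteq> 0" if "z \<in> cball 0 \<rho> - S" for z
    proof (cases "norm z = \<rho>")
      case True
      then show ?thesis using slice(3)[OF w0(1) True] by auto
    next
      case False
      show ?thesis
      proof
        assume "z - G z w0 = 0"
        then have "z \<in> ball 0 \<rho> \<and> z = G z w0" using False that by auto
        then have "z = fixpt \<rho> G w0" using fixpt_eqI[OF w0(1)] by blast
        then show False using that w0(2) by auto
      qed
    qed
    obtain U where U: "openin T U" "w0 \<in> U" "\<And>z w. z \<in> cball 0 \<rho> - S \<Longrightarrow> w \<in> U \<Longrightarrow> z - G z w \<in> - {0}"
      by (rule eventually_in_open_uniformly_on_compact[OF diff _ _ w0(1), of "cball 0 \<rho> - S" "- {0}"])
        (use nz S in \<open>auto intro: compact_diff\<close>)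
    have "fixpt \<rho> G w \<in> S" if "w \<in> U" for w
    proof -
      have "w \<in> topspace T" using openin_subset[OF U(1)] that by blast
      from fixpt_in_ball_and_fixed[OF this] show ?thesis
        using U(3)[OF _ that, of "fixpt \<rho> G w"] by auto
    qed
    then show "\<exists>U. openin T U \<and> w0 \<in> U \<and> U \<subseteq> {w \<in> topspace T. fixpt \<rho> G w \<in> S}"
      using U openin_subset[OF U(1)] by blast
  qed
qed auto

lemma lagrange_series_at:
  assumes w: "w \<in> topspace T"
  shows "(\<lambda>k. coeff_z (Suc k) (\<lambda>\<zeta>. lagrange_fun2 G H (Suc k) \<zeta> w)) sums (H (fixpt \<rho> G w) w - H 0 w)"
proof -
  obtain r where r: "0 < r" "r < \<rho>" "\<And>z. r \<le> norm z \<Longrightarrow> norm z < \<rho> \<Longrightarrow> norm (G z w) < norm z"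
    using lagrange_hyps_annulus[OF w] by blast
  from lagrange_inversion_at_fixed_point[OF r(1,2) slice(1,2)[OF w] r(3)] fixpt_in_ball_and_fixed[OF w]
  show ?thesis
    by (simp add: coeff_z_lagrange_fun2[where s=\<rho> and G=G and H=H and w=w, OF \<rho> slice(1,2)[OF w]])
qed

text \<open>The central estimate. The tube lemma gives a neighbourhood of \<open>w0\<close> on which \<open>|G| < q r\<close> on
  the circle of radius \<open>r\<close> and \<open>|H| < B\<close> on the disc. Cauchy's inequality for \<open>\<partial>H/\<partial>z\<close> and then for the
  \<open>k\<close>-th coefficient of \<open>(\<partial>H/\<partial>z) G\<^sup>k\<^sup>+\<^sup>1\<close> leaves the factor \<open>(q r)\<^sup>k\<^sup>+\<^sup>1 / r\<^sup>k\<close>. The estimate is made in the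
  first form of the series, which involves \<open>G\<close> itself but not its derivative.\<close>

lemma lagrange_terms_locally_geometric:
  assumes w0: "w0 \<in> topspace T"
  obtains U q C where "openin T U" "w0 \<in> U" "0 \<le> q" "q < 1"
    "\<And>k w. w \<in> U \<Longrightarrow> norm (coeff_z (Suc k) (\<lambda>\<zeta>. lagrange_fun2 G H (Suc k) \<zeta> w)) \<le> C * q ^ k"
proof -
  obtain r where r: "0 < r" "r < \<rho>" and less: "\<And>z. r \<le> norm z \<Longrightarrow> norm z < \<rho> \<Longrightarrow> norm (G z w0) < norm z"
    using lagrange_hyps_annulus[OF w0] by blast
  have sub: "sphere 0 r \<subseteq> cball (0::complex) \<rho>" using r by auto
  have ne: "sphere (0::complex) r \<noteq> {}" using r by simp
  have cG: "continuous_on (sphere 0 r) (\<lambda>z. G z w0)"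
    using cont_slice[OF cont_G w0] sub by (rule continuous_on_subset)
  obtain x where x: "norm x = r" "\<And>y. norm y = r \<Longrightarrow> norm (G y w0) \<le> norm (G x w0)"
    using continuous_attains_sup[OF compact_sphere ne continuous_on_norm[OF cG]] by auto
  obtain q where q: "norm (G x w0) / r < q" "q < 1"
    using dense[of "norm (G x w0) / r" 1] less[of x] x(1) r by auto
  have q0: "0 \<le> q" using q(1) r by (meson divide_nonneg_pos less_imp_le norm_ge_zero order_trans)
  obtain U1 where U1: "openin T U1" "w0 \<in> U1" "\<And>z w. z \<in> sphere 0 r \<Longrightarrow> w \<in> U1 \<Longrightarrow> G z w \<in> ball 0 (q * r)"
  proof (rule eventually_in_open_uniformly_on_compact[OF cont_G compact_sphere sub w0, of "ball 0 (q * r)"])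
    fix z :: complex assume "z \<in> sphere 0 r"
    then show "G z w0 \<in> ball 0 (q * r)" using x(2)[of z] q(1) r by (simp add: field_simps)
  qed auto
  have "cball (0::complex) \<rho> \<noteq> {}" using \<rho> by simp
  from continuous_attains_sup[OF compact_cball this continuous_on_norm[OF cont_slice[OF cont_H w0]]]
  obtain x' where x': "\<And>y. norm y \<le> \<rho> \<Longrightarrow> norm (H y w0) \<le> norm (H x' w0)" by (metis mem_cball_0)
  define B where "B = norm (H x' w0) + 1"
  obtain U2 where U2: "openin T U2" "w0 \<in> U2" "\<And>z w. z \<in> cball 0 \<rho> \<Longrightarrow> w \<in> U2 \<Longrightarrow> H z w \<in> ball 0 B"
  proof (rule eventually_in_open_uniformly_on_compact[OF cont_H compact_cball order_refl w0, of "ball 0 B"])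
    fix z :: complex assume "z \<in> cball 0 \<rho>"
    then show "H z w0 \<in> ball 0 B" using x'[of z] by (simp add: B_def)
  qed auto
  \<comment> \<open>Radius for Cauchy's inequality at points of the circle \<open>|z| = r\<close>: these discs stay in the
    open disc of radius \<open>\<rho>\<close>.\<close>
  define \<delta> where "\<delta> = (\<rho> - r) / 2"
  have \<delta>: "\<delta> > 0" "r + \<delta> < \<rho>" using r by (auto simp: \<delta>_def field_simps)
  show thesis
  proof (rule that[of "U1 \<inter> U2" q "B / \<delta> * q * r"])
    show "openin T (U1 \<inter> U2)" using U1 U2 by auto
    fix k w assume w: "w \<in> U1 \<inter> U2"
    then have wT: "w \<in> topspace T" using openin_subset[OF U1(1)] by auto
    have dH: "norm (deriv (\<lambda>z. H z w) z) \<le> B / \<delta>" if z: "norm z = r" for z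
    proof -
      have inb: "x \<in> ball 0 \<rho>" if "x \<in> cball z \<delta>" for x
        using that \<delta> z norm_triangle_ineq2[of x z] by (auto simp: dist_norm norm_minus_commute)
      have "norm ((deriv ^^ 1) (\<lambda>z. H z w) z) \<le> fact 1 * B / \<delta> ^ 1"
      proof (rule Cauchy_inequality)
        show "(\<lambda>z. H z w) holomorphic_on ball z \<delta>" "continuous_on (cball z \<delta>) (\<lambda>z. H z w)"
          using inb by (auto intro!: holomorphic_on_imp_continuous_on intro: holomorphic_on_subset[OF slice(2)[OF wT]])
        fix x assume "norm (z - x) = \<delta>"
        then have "x \<in> ball 0 \<rho>" by (intro inb) (simp add: dist_norm)
        then show "norm (H x w) \<le> B" using U2(3)[of x w] w by auto
      qed (use \<delta> in auto)
      then show ?thesis by simp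
    qed
    have "norm (coeff_z k (\<lambda>\<zeta>. lagrange_fun1 G H (Suc k) \<zeta> w)) \<le> (B / \<delta> * (q * r) ^ Suc k) / r ^ k"
    proof (rule coeff_z_bound[OF _ r])
      show "(\<lambda>\<zeta>. lagrange_fun1 G H (Suc k) \<zeta> w) holomorphic_on ball 0 \<rho>"
        unfolding lagrange_fun1_def using slice[OF wT] by (intro holomorphic_intros holomorphic_deriv) auto
      fix z :: complex assume z: "norm z = r"
      then show "norm (lagrange_fun1 G H (Suc k) z w) \<le> B / \<delta> * (q * r) ^ Suc k"
        unfolding lagrange_fun1_def norm_mult norm_power
        using dH[OF z] U1(3)[of z w] w by (intro mult_mono power_mono) (auto intro: order_trans[OF norm_ge_zero])
    qed
    also have "\<dots> = B / \<delta> * q * r * q ^ k" using r by (simp add: power_mult_distrib)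
    finally have *: "norm (coeff_z k (\<lambda>\<zeta>. lagrange_fun1 G H (Suc k) \<zeta> w)) \<le> B / \<delta> * q * r * q ^ k" .
    have "norm (1 / of_nat (Suc k) * coeff_z k (\<lambda>\<zeta>. lagrange_fun1 G H (Suc k) \<zeta> w)) \<le>
          1 * norm (coeff_z k (\<lambda>\<zeta>. lagrange_fun1 G H (Suc k) \<zeta> w))"
      unfolding norm_mult by (intro mult_right_mono) (auto simp: norm_divide simp del: of_nat_Suc)
    with * show "norm (coeff_z (Suc k) (\<lambda>\<zeta>. lagrange_fun2 G H (Suc k) \<zeta> w)) \<le> B / \<delta> * q * r * q ^ k"
      using lagrange_terms_eq[where s=\<rho> and G=G and H=H and w=w and k=k, OF \<rho> slice(1,2)[OF wT]] by simp
  qed (use U1 U2 q q0 in auto)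
qed

lemma loc_unif_abs_convergent_lagrange:
  "loc_unif_abs_convergent T (\<lambda>m w. coeff_z m (\<lambda>\<zeta>. lagrange_fun2 G H m \<zeta> w))"
  unfolding loc_unif_abs_convergent_def
proof (intro conjI ballI)
  fix w0 assume w0: "w0 \<in> topspace T"
  obtain U q C where U: "openin T U" "w0 \<in> U" "0 \<le> q" "q < 1"
    and bd: "\<And>k w. w \<in> U \<Longrightarrow> norm (coeff_z (Suc k) (\<lambda>\<zeta>. lagrange_fun2 G H (Suc k) \<zeta> w)) \<le> C * q ^ k"
    using lagrange_terms_locally_geometric[OF w0] by blast
  have sm: "summable (\<lambda>k. C * q ^ k)" using U by (intro summable_mult summable_geometric) auto
  show "summable (\<lambda>k. norm (coeff_z (Suc k) (\<lambda>\<zeta>. lagrange_fun2 G H (Suc k) \<zeta> w0)))"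
    by (rule summable_comparison_test'[OF sm]) (use bd[OF U(2)] in auto)
  show "\<exists>U. openin T U \<and> w0 \<in> U \<and>
      uniform_limit U (\<lambda>n x. \<Sum>k<n. norm (coeff_z (Suc k) (\<lambda>\<zeta>. lagrange_fun2 G H (Suc k) \<zeta> x)))
         (\<lambda>x. \<Sum>k. norm (coeff_z (Suc k) (\<lambda>\<zeta>. lagrange_fun2 G H (Suc k) \<zeta> x))) sequentially \<and>
      uniform_limit U (\<lambda>n x. \<Sum>k<n. coeff_z (Suc k) (\<lambda>\<zeta>. lagrange_fun2 G H (Suc k) \<zeta> x))
         (\<lambda>x. \<Sum>k. coeff_z (Suc k) (\<lambda>\<zeta>. lagrange_fun2 G H (Suc k) \<zeta> x)) sequentially"
    using U bd by (intro exI[of _ U] conjI Weierstrass_m_test[OF _ sm]) auto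
qed

lemma lagrange_terms_eq_on_topspace:
  assumes "w \<in> topspace T"
  shows "1 / of_nat (Suc k) * coeff_z k (\<lambda>\<zeta>. lagrange_fun1 G H (Suc k) \<zeta> w) = coeff_z (Suc k) (\<lambda>\<zeta>. lagrange_fun2 G H (Suc k) \<zeta> w)"
  by (rule lagrange_terms_eq[where s=\<rho> and G=G and H=H and w=w and k=k, OF \<rho> slice(1,2)[OF assms]])

end

lemma loc_unif_abs_convergent_cong:
  assumes "loc_unif_abs_convergent T f" "\<And>k w. w \<in> topspace T \<Longrightarrow> g (Suc k) w = f (Suc k) w"
  shows "loc_unif_abs_convergent T g"
  unfolding loc_unif_abs_convergent_def
proof (intro conjI ballI)
  fix w assume w: "w \<in> topspace T"
  show "summable (\<lambda>k. norm (g (Suc k) w))" using assms w by (simp add: loc_unif_abs_convergent_def)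
  obtain U where U: "openin T U" "w \<in> U"
    and lim: "uniform_limit U (\<lambda>n x. \<Sum>k<n. norm (f (Suc k) x)) (\<lambda>x. \<Sum>k. norm (f (Suc k) x)) sequentially"
      "uniform_limit U (\<lambda>n x. \<Sum>k<n. f (Suc k) x) (\<lambda>x. \<Sum>k. f (Suc k) x) sequentially"
    using assms(1) w unfolding loc_unif_abs_convergent_def by blast
  have eq: "g (Suc k) x = f (Suc k) x" if "x \<in> U" for k x
    using assms(2) openin_subset[OF U(1)] that by blast
  have "uniform_limit U (\<lambda>n x. \<Sum>k<n. norm (g (Suc k) x)) (\<lambda>x. \<Sum>k. norm (g (Suc k) x)) sequentially"
      "uniform_limit U (\<lambda>n x. \<Sum>k<n. g (Suc k) x) (\<lambda>x. \<Sum>k. g (Suc k) x) sequentially"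
    by (rule uniform_limit_cong'[THEN iffD2, OF _ _ lim(1)]; simp add: eq)
       (rule uniform_limit_cong'[THEN iffD2, OF _ _ lim(2)]; simp add: eq)
  with U show "\<exists>U. openin T U \<and> w \<in> U \<and>
      uniform_limit U (\<lambda>n x. \<Sum>k<n. norm (g (Suc k) x)) (\<lambda>x. \<Sum>k. norm (g (Suc k) x)) sequentially \<and>
      uniform_limit U (\<lambda>n x. \<Sum>k<n. g (Suc k) x) (\<lambda>x. \<Sum>k. g (Suc k) x) sequentially" by blast
qed

lemma lagrange_inversion_continuous:
  fixes T :: "'v topology"
  assumes "\<rho> > 0" "lagrange_hyps \<rho> T G H"
  shows "(\<forall>w\<in>topspace T. \<exists>!z. z \<in> ball 0 \<rho> \<and> z = G z w) \<and>
        continuous_map T euclidean (fixpt \<rho> G) \<and>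
        (let t1 = (\<lambda>m w. 1 / of_nat m * coeff_z (m - 1) (\<lambda>\<zeta>. lagrange_fun1 G H m \<zeta> w));
             t2 = (\<lambda>m w. coeff_z m (\<lambda>\<zeta>. lagrange_fun2 G H m \<zeta> w))
         in loc_unif_abs_convergent T t1 \<and>
            loc_unif_abs_convergent T t2 \<and>
            (\<forall>w\<in>topspace T.
               H (fixpt \<rho> G w) w = H 0 w + (\<Sum>k. t1 (Suc k) w) \<and>
               H (fixpt \<rho> G w) w = H 0 w + (\<Sum>k. t2 (Suc k) w)))"
proof -
  note ass = assms(2,1)
  have eq: "1 / of_nat (Suc k) * coeff_z (Suc k - 1) (\<lambda>\<zeta>. lagrange_fun1 G H (Suc k) \<zeta> w)
      = coeff_z (Suc k) (\<lambda>\<zeta>. lagrange_fun2 G H (Suc k) \<zeta> w)" if "w \<in> topspace T" for k w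
    using lagrange_terms_eq_on_topspace[OF ass that] by simp
  have sum2: "H (fixpt \<rho> G w) w = H 0 w + (\<Sum>k. coeff_z (Suc k) (\<lambda>\<zeta>. lagrange_fun2 G H (Suc k) \<zeta> w))"
    if "w \<in> topspace T" for w
    using sums_unique[OF lagrange_series_at[OF ass that]] by (metis add.commute diff_add_cancel)
  show ?thesis
    unfolding Let_def
    using lagrange_fixpt_ex1[OF ass] continuous_map_fixpt[OF ass] sum2
      loc_unif_abs_convergent_lagrange[OF ass]
      loc_unif_abs_convergent_cong[OF loc_unif_abs_convergent_lagrange[OF ass], of "\<lambda>m w. 1 / of_nat m * coeff_z (m - 1) (\<lambda>\<zeta>. lagrange_fun1 G H m \<zeta> w)", OF eq]
    by (intro conjI ballI) (simp_all only: eq cong: suminf_cong)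
qed


section \<open>Separately holomorphic functions\<close>

text \<open>Traces the affine complex lines along which holomorphy in one coordinate is tested.\<close>

definition upd :: "complex ^ 'm \<Rightarrow> 'm::finite \<Rightarrow> complex \<Rightarrow> complex ^ 'm" where
  "upd w i x = (\<chi> j. if j = i then x else w $ j)"

lemma upd_nth [simp]: "upd w i x $ j = (if j = i then x else w $ j)"
  by (simp add: upd_def)

lemma upd_same [simp]: "upd w i (w $ i) = w"
  by (simp add: vec_eq_iff)

lemma upd_upd [simp]: "upd (upd w i x) i y = upd w i y"
  by (simp add: vec_eq_iff)

lemma upd_commute: "i \<noteq> j \<Longrightarrow> upd (upd w i x) j y = upd (upd w j y) i x"
  by (auto simp: vec_eq_iff)

lemma continuous_on_upd [continuous_intros]:
  assumes "continuous_on S f" "continuous_on S g"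
  shows "continuous_on S (\<lambda>x. upd (f x) i (g x))"
  unfolding upd_def
proof (rule continuous_on_vec_lambda)
  show "continuous_on S (\<lambda>x. if j = i then g x else f x $ j)" for j
    by (cases "j = i") (auto intro!: continuous_intros assms)
qed

text \<open>The hypotheses of Osgood's lemma. Only field operations, one-variable calculus and uniform limits
  are needed to verify them, and on open sets they are equivalent to analyticity in the sense of
  local power series.\<close>

definition sep_holo :: "(complex ^ 'm::finite \<Rightarrow> complex) \<Rightarrow> (complex ^ 'm) set \<Rightarrow> bool" where
  "sep_holo f V \<longleftrightarrow> continuous_on V f \<and>
     (\<forall>w\<in>V. \<forall>i. (\<lambda>x. f (upd w i x)) field_differentiable at (w $ i))"

lemma sep_holoI:
  assumes "continuous_on V f" "\<And>w i. w \<in> V \<Longrightarrow> (\<lambda>x. f (upd w i x)) field_differentiable at (w $ i)"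
  shows "sep_holo f V"
  using assms by (auto simp: sep_holo_def)

lemma sep_holo_continuous: "sep_holo f V \<Longrightarrow> continuous_on V f"
  by (simp add: sep_holo_def)

lemma sep_holo_subset: "sep_holo f V \<Longrightarrow> U \<subseteq> V \<Longrightarrow> sep_holo f U"
  by (auto simp: sep_holo_def intro: continuous_on_subset)

lemma sep_holo_slice:
  assumes "sep_holo f V" "\<And>x. x \<in> B \<Longrightarrow> upd w i x \<in> V"
  shows "(\<lambda>x. f (upd w i x)) holomorphic_on B"
  unfolding holomorphic_on_def
proof
  fix x assume "x \<in> B"
  then have "upd w i x \<in> V" by (rule assms(2))
  with assms(1) have "(\<lambda>y. f (upd (upd w i x) i y)) field_differentiable at (upd w i x $ i)"
    unfolding sep_holo_def by blast
  then show "(\<lambda>x. f (upd w i x)) field_differentiable at x within B"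
    by (simp add: field_differentiable_at_within)
qed

lemma sep_holo_const [simp, intro]: "sep_holo (\<lambda>w. c) V"
  by (simp add: sep_holo_def)

lemma sep_holo_mult: "sep_holo f V \<Longrightarrow> sep_holo g V \<Longrightarrow> sep_holo (\<lambda>w. f w * g w) V"
  by (auto simp: sep_holo_def intro!: continuous_intros field_differentiable_mult)

lemma sep_holo_add: "sep_holo f V \<Longrightarrow> sep_holo g V \<Longrightarrow> sep_holo (\<lambda>w. f w + g w) V"
  by (auto simp: sep_holo_def intro!: continuous_intros field_differentiable_add)

lemma sep_holo_sum: "(\<And>k. k \<in> K \<Longrightarrow> sep_holo (f k) V) \<Longrightarrow> sep_holo (\<lambda>w. \<Sum>k\<in>K. f k w) V"
  by (induction K rule: infinite_finite_induct) (auto intro: sep_holo_add)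

lemma sep_holo_diff: 
  assumes "sep_holo f V" "sep_holo g V" shows "sep_holo (\<lambda>w. f w - g w) V"
  using sep_holo_add[OF assms(1) sep_holo_mult[OF sep_holo_const assms(2), of "-1"]] by simp

lemma sep_holo_local:
  assumes "\<And>w. w \<in> V \<Longrightarrow> \<exists>U. open U \<and> w \<in> U \<and> sep_holo f U"
  shows "sep_holo f V"
proof (rule sep_holoI)
  show "continuous_on V f"
  proof (rule continuous_at_imp_continuous_on, rule ballI)
    fix w assume "w \<in> V"
    then show "isCont f w"
      using assms continuous_on_eq_continuous_at sep_holo_continuous by blast
  qed
qed (use assms in \<open>auto simp: sep_holo_def\<close>)

text \<open>Weierstrass' theorem on each coordinate line.\<close>

lemma sep_holo_uniform_limit:
  assumes U: "open U" and f: "\<And>n. sep_holo (f n) U" and lim: "uniform_limit U f g F" and F: "F \<noteq> bot"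
  shows "sep_holo g U"
proof (rule sep_holoI)
  show "continuous_on U g"
    by (rule uniform_limit_theorem[OF _ lim F]) (use f in \<open>auto simp: sep_holo_def\<close>)
  fix w i assume w: "w \<in> U"
  have "continuous_on UNIV (\<lambda>x. upd w i x)" by (intro continuous_intros)
  then have "open ((\<lambda>x. upd w i x) -` U)" using U by (simp add: open_vimage)
  moreover have "w $ i \<in> (\<lambda>x. upd w i x) -` U" using w by simp
  ultimately obtain e where e: "e > 0" "cball (w $ i) e \<subseteq> (\<lambda>x. upd w i x) -` U"
    using open_contains_cball by blast
  have hol: "(\<lambda>x. f n (upd w i x)) holomorphic_on cball (w $ i) e" for n
    by (rule sep_holo_slice[OF f]) (use e in auto)
  have "uniform_limit (cball (w $ i) e) (\<lambda>n x. f n (upd w i x)) (\<lambda>x. g (upd w i x)) F"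
    by (rule uniform_limit_compose'[OF lim]) (use e in auto)
  then have "(\<lambda>x. g (upd w i x)) holomorphic_on ball (w $ i) e"
  proof (rule holomorphic_uniform_limit[rotated])
    show "\<forall>\<^sub>F n in F. continuous_on (cball (w $ i) e) (\<lambda>x. f n (upd w i x)) \<and>
        (\<lambda>x. f n (upd w i x)) holomorphic_on ball (w $ i) e"
      using hol by (intro always_eventually allI conjI holomorphic_on_imp_continuous_on holomorphic_on_subset[OF hol ball_subset_cball])
  qed (use F in auto)
  then show "(\<lambda>x. g (upd w i x)) field_differentiable at (w $ i)"
    using e by (auto intro: holomorphic_on_imp_differentiable_at)
qed

lemma sep_holo_cong:
  assumes V: "open V" and "sep_holo f V" "\<And>w. w \<in> V \<Longrightarrow> f w = g w"
  shows "sep_holo g V"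
proof (rule sep_holo_uniform_limit[OF V, of "\<lambda>_. f" g sequentially])
  show "uniform_limit V (\<lambda>_. f) g sequentially"
    by (rule uniform_limitI) (use assms in auto)
qed (use assms in auto)

lemma sep_holo_translate:
  assumes "sep_holo f V"
  shows "sep_holo (\<lambda>w. f (w + b)) {w. w + b \<in> V}"
proof (rule sep_holoI)
  show "continuous_on {w. w + b \<in> V} (\<lambda>w. f (w + b))"
    by (rule continuous_on_compose2[OF sep_holo_continuous[OF assms]]) (auto intro!: continuous_intros)
  fix w i assume "w \<in> {w. w + b \<in> V}"
  then have "(\<lambda>x. f (upd (w + b) i x)) field_differentiable at ((w + b) $ i)"
    using assms unfolding sep_holo_def by blast
  then have "(\<lambda>x. f (upd (w + b) i x)) field_differentiable at (w $ i + b $ i)" by simp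
  then have "((\<lambda>x. f (upd (w + b) i x)) \<circ> (\<lambda>x. x + b $ i)) field_differentiable at (w $ i)"
    by (intro field_differentiable_compose field_differentiable_add) auto
  moreover have "upd (w + b) i (x + b $ i) = upd w i x + b" for x by (auto simp: vec_eq_iff)
  ultimately show "(\<lambda>x. f (upd w i x + b)) field_differentiable at (w $ i)" by (simp add: o_def)
qed

text \<open>The same notion for functions of \<open>(z, w)\<close>, with the first variable kept apart since Taylor
  coefficients are taken with respect to it while \<open>w\<close> is a parameter.\<close>

definition joint_holo :: "(complex \<Rightarrow> complex ^ 'm::finite \<Rightarrow> complex) \<Rightarrow> complex set \<Rightarrow> (complex ^ 'm) set \<Rightarrow> bool" where
  "joint_holo F A V \<longleftrightarrow> continuous_on (A \<times> V) (\<lambda>(z, w). F z w) \<and>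
     (\<forall>w\<in>V. (\<lambda>z. F z w) holomorphic_on A) \<and> (\<forall>z\<in>A. sep_holo (F z) V)"

lemma joint_holo_mult: 
  "joint_holo F A V \<Longrightarrow> joint_holo G A V \<Longrightarrow> joint_holo (\<lambda>z w. F z w * G z w) A V"
  by (auto simp: joint_holo_def case_prod_unfold intro!: continuous_intros holomorphic_intros sep_holo_mult)

lemma joint_holo_diff:
  assumes "joint_holo F A V" "joint_holo G A V" shows "joint_holo (\<lambda>z w. F z w - G z w) A V"
  using assms by (auto simp: joint_holo_def case_prod_unfold intro!: continuous_intros holomorphic_intros sep_holo_diff)

lemma joint_holo_const: "joint_holo (\<lambda>z w. c) A V"
  by (auto simp: joint_holo_def)

lemma joint_holo_fst: "joint_holo (\<lambda>z w. z) A V"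
  by (auto simp: joint_holo_def case_prod_unfold intro!: continuous_intros)

lemma joint_holo_power: "joint_holo F A V \<Longrightarrow> joint_holo (\<lambda>z w. F z w ^ n) A V"
  by (induction n) (auto intro: joint_holo_mult joint_holo_const)

text \<open>Taylor's formula of second order; the second derivative is bounded on the half disc by Cauchy's
  inequality with radius \<open>R / 4\<close>. The point is that the bound depends on \<open>f\<close> only through \<open>M\<close>, which makes
  difference quotients converge uniformly in a parameter.\<close>

lemma difference_quotient_bound:
  fixes f :: "complex \<Rightarrow> complex"
  assumes hol: "f holomorphic_on ball z R" and M: "\<And>x. x \<in> ball z R \<Longrightarrow> norm (f x) \<le> M"
    and h: "h \<noteq> 0" "norm h < R / 2"
  shows "norm ((f (z + h) - f z) / h - deriv f z) \<le> 32 * M / R\<^sup>2 * norm h"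
proof -
  have R: "R > 0" using h norm_ge_zero[of h] by linarith
  have sub: "ball z (R / 2) \<subseteq> ball z R" using R by auto
  have d2: "norm ((deriv ^^ 2) f x) \<le> 32 * M / R\<^sup>2" if x: "x \<in> ball z (R / 2)" for x
  proof -
    have inb: "y \<in> ball z R" if "y \<in> cball x (R / 4)" for y
      using that x R dist_triangle[of z y x] by auto
    have "norm ((deriv ^^ 2) f x) \<le> fact 2 * M / (R / 4) ^ 2"
    proof (rule Cauchy_inequality)
      show "f holomorphic_on ball x (R / 4)" "continuous_on (cball x (R / 4)) f"
        using inb by (auto intro!: holomorphic_on_imp_continuous_on intro: holomorphic_on_subset[OF hol])
      fix y assume "norm (x - y) = R / 4"
      then show "norm (f y) \<le> M" by (intro M inb) (simp add: dist_norm)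
    qed (use R in auto)
    then show ?thesis by (simp add: power_divide fact_2 field_simps)
  qed
  have "norm ((deriv ^^ 0) f (z + h) - (\<Sum>i\<le>1. (deriv ^^ i) f z * (z + h - z) ^ i / fact i))
      \<le> 32 * M / R\<^sup>2 * norm (z + h - z) ^ Suc 1 / fact 1"
  proof (rule complex_Taylor[where S = "ball z (R / 2)" and f = "\<lambda>i. (deriv ^^ i) f"])
    fix i x assume "x \<in> ball z (R / 2)"
    then show "((deriv ^^ i) f has_field_derivative (deriv ^^ Suc i) f x) (at x within ball z (R / 2))"
      using holomorphic_derivI[OF holomorphic_higher_deriv[OF hol open_ball], of x i] sub
      by (auto intro: has_field_derivative_at_within)
  next
    fix x assume "x \<in> ball z (R / 2)"
    from d2[OF this] show "norm ((deriv ^^ Suc 1) f x) \<le> 32 * M / R\<^sup>2" by (simp add: numeral_2_eq_2)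
  qed (use R h in \<open>auto simp: dist_norm\<close>)
  then have "norm (f (z + h) - f z - deriv f z * h) \<le> 32 * M / R\<^sup>2 * norm h * norm h"
    by (simp add: algebra_simps power2_eq_square)
  moreover have "(f (z + h) - f z) / h - deriv f z = (f (z + h) - f z - deriv f z * h) / h"
    using h by (simp add: field_simps)
  ultimately show ?thesis using h by (simp add: norm_divide divide_le_eq)
qed

text \<open>Near a given point the difference quotients in \<open>z\<close> belong to the class and, by
  \<open>difference_quotient_bound\<close>, converge uniformly to \<open>\<partial>F/\<partial>z\<close>; both joint continuity and holomorphy in
  the coordinates of \<open>w\<close> pass to the limit.\<close>

lemma joint_holo_deriv:
  assumes F: "joint_holo F A V" and A: "open A" and V: "open V"
  shows "joint_holo (\<lambda>z w. deriv (\<lambda>z. F z w) z) A V"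
proof -
  let ?D = "\<lambda>z w. deriv (\<lambda>z. F z w) z"
  have loc: "\<exists>s Q. s > 0 \<and> ball z0 s \<subseteq> A \<and> ball w0 s \<subseteq> V \<and>
      (\<forall>n. joint_holo (Q n) (ball z0 s) (ball w0 s)) \<and>
      uniform_limit (ball z0 s \<times> ball w0 s) (\<lambda>n (z, w). Q n z w) (\<lambda>(z, w). ?D z w) sequentially"
    if z0w0: "z0 \<in> A" "w0 \<in> V" for z0 w0
  proof -
    obtain s1 where s1: "s1 > 0" "cball z0 s1 \<subseteq> A" using open_contains_cball_eq[OF A] z0w0(1) by metis
    obtain s2 where s2: "s2 > 0" "cball w0 s2 \<subseteq> V" using open_contains_cball_eq[OF V] z0w0(2) by metis
    \<comment> \<open>For \<open>z\<close> within \<open>s\<close> of \<open>z0\<close> the disc of radius \<open>2 s\<close> about \<open>z\<close> has to stay where \<open>F\<close> is bounded.\<close>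
    define s where "s = min (s1 / 4) s2"
    have s: "s > 0" "4 * s \<le> s1" "s \<le> s2" using s1 s2 by (auto simp: s_def)
    have sub: "cball z0 (4 * s) \<subseteq> A" "cball w0 s \<subseteq> V" using s1 s2 s by (auto simp: subset_iff)
    have c: "continuous_on (cball z0 (4 * s) \<times> cball w0 s) (\<lambda>(z, w). F z w)"
      by (rule continuous_on_subset[of "A \<times> V"]) (use F sub in \<open>auto simp: joint_holo_def\<close>)
    then have "compact ((\<lambda>(z, w). F z w) ` (cball z0 (4 * s) \<times> cball w0 s))"
      by (intro compact_continuous_image compact_Times) auto
    then obtain M where M: "\<forall>x \<in> (\<lambda>(z, w). F z w) ` (cball z0 (4 * s) \<times> cball w0 s). norm x \<le> M"
      using compact_imp_bounded bounded_iff by metis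
    have M: "norm (F z w) \<le> M" if "z \<in> cball z0 (4 * s)" "w \<in> cball w0 s" for z w
    proof -
      have "F z w \<in> (\<lambda>(z, w). F z w) ` (cball z0 (4 * s) \<times> cball w0 s)"
        using that by (intro image_eqI[of _ _ "(z, w)"]) auto
      with M show ?thesis by blast
    qed
    \<comment> \<open>The summand 2 keeps all increments strictly below \<open>s\<close>, half the radius used for the quotients.\<close>
    define h where "h n = complex_of_real (s / (2 + real n))" for n
    have hn: "norm (h n) = s / (2 + real n)" for n
      unfolding h_def norm_of_real using s by simp
    have h: "h n \<noteq> 0" "norm (h n) < s" for n
    proof -
      have "s / (2 + real n) < s / 1" using s by (intro divide_strict_left_mono) auto
      then show "norm (h n) < s" by (simp add: hn)
      have "0 < norm (h n)" unfolding hn using s by (intro divide_pos_pos) auto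
      then show "h n \<noteq> 0" by auto
    qed
    define Q where "Q n z w = (F (z + h n) w - F z w) / h n" for n z w
    have shift: "z + h n \<in> cball z0 (4 * s)" if "z \<in> ball z0 s" for z n
    proof -
      have "norm (z + h n - z0) \<le> norm (z - z0) + norm (h n)"
        using norm_triangle_ineq[of "z - z0" "h n"] by (simp add: algebra_simps)
      then show ?thesis using h(2)[of n] that s(1) by (auto simp: dist_norm norm_minus_commute)
    qed
    have ballsub: "ball z0 s \<subseteq> cball z0 (4 * s)" using s by auto
    have "joint_holo (Q n) (ball z0 s) (ball w0 s)" for n
      unfolding joint_holo_def
    proof (intro conjI ballI)
      have "continuous_on (ball z0 s \<times> ball w0 s) (\<lambda>x. (\<lambda>(z, w). F z w) (fst x + h n, snd x))"
        by (rule continuous_on_compose2[OF c]) (use shift in \<open>auto intro!: continuous_intros\<close>)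
      moreover have "continuous_on (ball z0 s \<times> ball w0 s) (\<lambda>x. (\<lambda>(z, w). F z w) (fst x, snd x))"
        by (rule continuous_on_compose2[OF c]) (use ballsub in \<open>auto intro!: continuous_intros\<close>)
      ultimately show "continuous_on (ball z0 s \<times> ball w0 s) (\<lambda>(z, w). Q n z w)"
        unfolding Q_def case_prod_unfold using h(1) by (intro continuous_intros) auto
    next
      fix w assume w: "w \<in> ball w0 s"
      then have "w \<in> V" using sub(2) by auto
      then have "(\<lambda>z. F z w) holomorphic_on A" using F by (auto simp: joint_holo_def)
      then have hF: "(\<lambda>z. F z w) holomorphic_on cball z0 (4 * s)"
        using sub(1) by (rule holomorphic_on_subset)
      have "((\<lambda>z. F z w) \<circ> (\<lambda>z. z + h n)) holomorphic_on ball z0 s"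
        by (rule holomorphic_on_compose_gen[OF _ hF]) (use shift in \<open>auto intro!: holomorphic_intros\<close>)
      then have "(\<lambda>z. F (z + h n) w) holomorphic_on ball z0 s" by (simp add: o_def)
      then show "(\<lambda>z. Q n z w) holomorphic_on ball z0 s"
        unfolding Q_def using h(1) holomorphic_on_subset[OF hF ballsub]
        by (intro holomorphic_intros) auto
    next
      fix z assume z: "z \<in> ball z0 s"
      have "z \<in> A" "z + h n \<in> A" using z shift[OF z] sub ballsub by auto
      moreover have "ball w0 s \<subseteq> V" using sub by auto
      ultimately have "sep_holo (F (z + h n)) (ball w0 s)" "sep_holo (F z) (ball w0 s)"
        using F sep_holo_subset unfolding joint_holo_def by blast+
      from sep_holo_mult[OF sep_holo_diff[OF this] sep_holo_const[of "1 / h n"]]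
      show "sep_holo (Q n z) (ball w0 s)" by (simp add: Q_def[abs_def])
    qed
    moreover have "uniform_limit (ball z0 s \<times> ball w0 s) (\<lambda>n (z, w). Q n z w) (\<lambda>(z, w). ?D z w) sequentially"
    proof (rule uniform_limitI)
      fix e :: real assume e: "e > 0"
      have bd: "norm (Q n z w - ?D z w) \<le> 32 * M / (2 * s)\<^sup>2 * norm (h n)"
        if "z \<in> ball z0 s" "w \<in> ball w0 s" for n z w
        unfolding Q_def
      proof (rule difference_quotient_bound[of "\<lambda>z. F z w" z])
        have sub': "ball z (2 * s) \<subseteq> cball z0 (4 * s)"
        proof
          fix x assume "x \<in> ball z (2 * s)"
          then show "x \<in> cball z0 (4 * s)"
            using that(1) s(1) dist_triangle[of z0 x z] by (simp add: dist_commute)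
        qed
        have "w \<in> V" using that(2) sub(2) by auto
        then have "(\<lambda>z. F z w) holomorphic_on A" using F by (auto simp: joint_holo_def)
        then show "(\<lambda>z. F z w) holomorphic_on ball z (2 * s)"
          using sub' sub(1) by (rule holomorphic_on_subset[OF _ subset_trans])
        fix x assume "x \<in> ball z (2 * s)"
        then show "norm (F x w) \<le> M" using sub' that(2) by (intro M) auto
      qed (use h in auto)
      have "(\<lambda>n. 32 * M / (2 * s)\<^sup>2 * norm (h n)) \<longlonglongrightarrow> 0"
        unfolding hn by real_asymp
      then have "eventually (\<lambda>n. 32 * M / (2 * s)\<^sup>2 * norm (h n) < e) sequentially"
        using e by (rule order_tendstoD)
      then show "\<forall>\<^sub>F n in sequentially. \<forall>x\<in>ball z0 s \<times> ball w0 s.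
          dist (case x of (z, w) \<Rightarrow> Q n z w) (case x of (z, w) \<Rightarrow> ?D z w) < e"
      proof eventually_elim
        case (elim n)
        show ?case
        proof safe
          fix z w assume "z \<in> ball z0 s" "w \<in> ball w0 s"
          from le_less_trans[OF bd[OF this] elim]
          show "dist (Q n z w) (?D z w) < e" by (simp add: dist_norm)
        qed
      qed
    qed
    ultimately show ?thesis
      using s sub by (intro exI[of _ s] exI[of _ Q]) auto
  qed
  show ?thesis
    unfolding joint_holo_def
  proof (intro conjI ballI)
    show "continuous_on (A \<times> V) (\<lambda>(z, w). ?D z w)"
    proof (rule continuous_at_imp_continuous_on, safe)
      fix z0 w0 assume "z0 \<in> A" "w0 \<in> V"
      from loc[OF this] obtain s Q where sQ: "s > 0" "\<And>n. joint_holo (Q n) (ball z0 s) (ball w0 s)"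
        and lim: "uniform_limit (ball z0 s \<times> ball w0 s) (\<lambda>n (z, w). Q n z w) (\<lambda>(z, w). ?D z w) sequentially"
        by blast
      have "continuous_on (ball z0 s \<times> ball w0 s) (\<lambda>(z, w). ?D z w)"
        by (rule uniform_limit_theorem[OF _ lim]) (use sQ(2) in \<open>auto simp: joint_holo_def\<close>)
      then show "isCont (\<lambda>(z, w). ?D z w) (z0, w0)"
        using sQ(1) by (subst (asm) continuous_on_eq_continuous_at) (auto intro: open_Times)
    qed
  next
    fix w assume "w \<in> V"
    then show "(\<lambda>z. ?D z w) holomorphic_on A"
      using F A by (auto simp: joint_holo_def intro!: holomorphic_deriv)
  next
    fix z0 assume z0: "z0 \<in> A"
    show "sep_holo (?D z0) V"
    proof (rule sep_holo_local)
      fix w0 assume "w0 \<in> V"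
      from loc[OF z0 this] obtain s Q where sQ: "s > 0" "\<And>n. joint_holo (Q n) (ball z0 s) (ball w0 s)"
        and lim: "uniform_limit (ball z0 s \<times> ball w0 s) (\<lambda>n (z, w). Q n z w) (\<lambda>(z, w). ?D z w) sequentially"
        by blast
      have "uniform_limit (ball w0 s) (\<lambda>n w. (case (z0, w) of (z, w) \<Rightarrow> Q n z w)) (\<lambda>w. (case (z0, w) of (z, w) \<Rightarrow> ?D z w)) sequentially"
        by (rule uniform_limit_compose'[OF lim]) (use sQ(1) in auto)
      then have "uniform_limit (ball w0 s) (\<lambda>n. Q n z0) (?D z0) sequentially" by simp
      then have "sep_holo (?D z0) (ball w0 s)"
        by (rule sep_holo_uniform_limit[rotated 2]) (use sQ in \<open>auto simp: joint_holo_def\<close>)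
      then show "\<exists>U. open U \<and> w0 \<in> U \<and> sep_holo (?D z0) U"
        using sQ(1) by (intro exI[of _ "ball w0 s"]) auto
    qed
  qed
qed

lemma joint_holo_higher_deriv:
  assumes "joint_holo F A V" "open A" "open V"
  shows "joint_holo (\<lambda>z w. (deriv ^^ n) (\<lambda>z. F z w) z) A V"
proof (induction n)
  case (Suc n)
  from joint_holo_deriv[OF this assms(2,3)] show ?case by simp
qed (use assms in simp)

lemma sep_holo_coeff_z:
  assumes "joint_holo F A V" "open A" "open V" "0 \<in> A"
  shows "sep_holo (\<lambda>w. coeff_z n (\<lambda>z. F z w)) V"
proof -
  have "sep_holo (\<lambda>w. (deriv ^^ n) (\<lambda>z. F z w) 0) V"
    using joint_holo_higher_deriv[OF assms(1-3), of n] assms(4) by (auto simp: joint_holo_def)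
  from sep_holo_mult[OF this sep_holo_const[of "1 / fact n"]] show ?thesis by (simp add: coeff_z_def)
qed


section \<open>Power series on polydiscs\<close>

definition polydisc :: "('m::finite \<Rightarrow> real) \<Rightarrow> (complex ^ 'm) set" where
  "polydisc R = {w. \<forall>i. norm (w $ i) < R i}"

lemma open_polydisc: "open (polydisc R)"
proof -
  have "polydisc R = (\<Inter>i. {w. norm (w $ i) < R i})" by (auto simp: polydisc_def)
  then show ?thesis by (auto intro!: open_INT open_Collect_less continuous_intros)
qed

lemma upd_in_polydisc: "w \<in> polydisc R \<Longrightarrow> norm x < R i \<Longrightarrow> upd w i x \<in> polydisc R"
  by (auto simp: polydisc_def)

lemma norm_mpow: "norm (mpow w \<alpha>) = (\<Prod>i\<in>UNIV. norm (w $ i) ^ \<alpha> i)"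
  by (simp add: mpow_def norm_power flip: prod_norm)

lemma prod_power_upd:
  fixes x :: "'m::finite \<Rightarrow> 'a::comm_semiring_1"
  shows "(\<Prod>j\<in>UNIV. x j ^ \<alpha> j) = x i ^ \<alpha> i * (\<Prod>j\<in>UNIV. x j ^ (\<alpha>(i := 0)) j)"
  by (subst (1 2) prod.remove[of _ i]) (auto intro!: arg_cong2[of _ _ _ _ "(*)"] prod.cong)

lemma mpow_fun_upd:
  assumes "\<beta> i = 0"
  shows "mpow (upd w i x) (\<beta>(i := n)) = x ^ n * mpow w \<beta>"
  unfolding mpow_def
  by (subst (1 2) prod.remove[of _ i]) (use assms in \<open>auto intro!: arg_cong2[of _ _ _ _ "(*)"] prod.cong\<close>)

text \<open>The multiple geometric series, the majorant for all power series on polydiscs.\<close>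

lemma multi_geometric_summable:
  fixes x :: "'m::finite \<Rightarrow> real"
  assumes "\<And>i. 0 \<le> x i" "\<And>i. x i < 1"
  shows "(\<lambda>\<alpha>. \<Prod>i\<in>UNIV. x i ^ \<alpha> i) summable_on UNIV"
proof -
  have "Infinite_Set_Sum.abs_summable_on (\<lambda>\<alpha>. \<Prod>i\<in>UNIV. x i ^ \<alpha> i) (PiE UNIV (\<lambda>_. UNIV))"
    by (rule abs_summable_on_prod_PiE) (use assms in \<open>auto simp: abs_summable_on_nat_iff' norm_power\<close>)
  then have "Infinite_Sum.abs_summable_on (\<lambda>\<alpha>. \<Prod>i\<in>UNIV. x i ^ \<alpha> i) UNIV"
    by (simp only: abs_summable_equivalent PiE_UNIV UNIV_def[symmetric] PiE_UNIV_domain Pi_UNIV)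
  then show ?thesis by (rule abs_summable_summable)
qed

lemma power_terms_norm_summable:
  fixes c :: "('m::finite \<Rightarrow> nat) \<Rightarrow> complex"
  assumes w: "w \<in> polydisc R" and c: "\<And>\<alpha>. \<alpha> \<in> I \<Longrightarrow> norm (c \<alpha>) \<le> B / (\<Prod>i\<in>UNIV. R i ^ \<alpha> i)"
  shows "(\<lambda>\<alpha>. norm (c \<alpha> * mpow w \<alpha>)) summable_on I"
proof -
  have R: "R i > 0" for i using w by (auto simp: polydisc_def intro: le_less_trans[OF norm_ge_zero])
  define x where "x i = norm (w $ i) / R i" for i
  have "(\<lambda>\<alpha>. \<Prod>i\<in>UNIV. x i ^ \<alpha> i) summable_on UNIV"
    using w R by (intro multi_geometric_summable) (auto simp: x_def polydisc_def less_imp_le divide_nonneg_pos)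
  then have "(\<lambda>\<alpha>. B * (\<Prod>i\<in>UNIV. x i ^ \<alpha> i)) summable_on I"
    by (intro summable_on_cmult_right) (auto intro: summable_on_subset_banach)
  then show ?thesis
  proof (rule summable_on_comparison_test)
    fix \<alpha> assume \<alpha>: "\<alpha> \<in> I"
    have "norm (c \<alpha> * mpow w \<alpha>) \<le> B / (\<Prod>i\<in>UNIV. R i ^ \<alpha> i) * (\<Prod>i\<in>UNIV. norm (w $ i) ^ \<alpha> i)"
      unfolding norm_mult norm_mpow by (intro mult_right_mono c \<alpha> prod_nonneg) auto
    also have "\<dots> = B * (\<Prod>i\<in>UNIV. x i ^ \<alpha> i)"
      by (simp add: x_def power_divide prod_dividef)
    finally show "norm (c \<alpha> * mpow w \<alpha>) \<le> B * (\<Prod>i\<in>UNIV. x i ^ \<alpha> i)" .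
  qed auto
qed

text \<open>Singling out the \<open>i\<close>-th coordinate as the variable \<open>z\<close> makes the coefficients of an expansion in
  this coordinate accessible to \<open>sep_holo_coeff_z\<close>.\<close>

lemma joint_holo_coordinate:
  assumes "sep_holo c (polydisc R)"
  shows "joint_holo (\<lambda>z w. c (upd w i z)) (ball 0 (R i)) (polydisc R)"
  unfolding joint_holo_def
proof (intro conjI ballI)
  show "continuous_on (ball 0 (R i) \<times> polydisc R) (\<lambda>(z, w). c (upd w i z))"
    unfolding case_prod_unfold
    by (rule continuous_on_compose2[OF sep_holo_continuous[OF assms]])
      (auto intro!: continuous_intros upd_in_polydisc)
next
  fix w assume "w \<in> polydisc R"
  then show "(\<lambda>z. c (upd w i z)) holomorphic_on ball 0 (R i)"
    by (intro sep_holo_slice[OF assms] upd_in_polydisc) auto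
next
  fix z :: complex assume z: "z \<in> ball 0 (R i)"
  show "sep_holo (\<lambda>w. c (upd w i z)) (polydisc R)"
  proof (rule sep_holoI)
    show "continuous_on (polydisc R) (\<lambda>w. c (upd w i z))"
      by (rule continuous_on_compose2[OF sep_holo_continuous[OF assms]])
        (use z in \<open>auto intro!: continuous_intros upd_in_polydisc\<close>)
    fix w j assume w: "w \<in> polydisc R"
    show "(\<lambda>x. c (upd (upd w j x) i z)) field_differentiable at (w $ j)"
    proof (cases "j = i")
      case False
      have "upd w i z \<in> polydisc R" using z w by (intro upd_in_polydisc) auto
      then have "(\<lambda>x. c (upd (upd w i z) j x)) field_differentiable at (upd w i z $ j)"
        using assms unfolding sep_holo_def by blast
      then show ?thesis using False by (simp add: upd_commute[OF False])
    qed simp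
  qed
qed

text \<open>The exponents that occur after expansion in the coordinates of \<open>S\<close> only.\<close>

definition supp_in :: "'m set \<Rightarrow> ('m \<Rightarrow> nat) set" where
  "supp_in S = {\<alpha>. \<forall>i. i \<notin> S \<longrightarrow> \<alpha> i = 0}"

lemma supp_in_empty [simp]: "supp_in {} = {\<lambda>_. 0}" and supp_in_UNIV [simp]: "supp_in UNIV = UNIV"
  by (auto simp: supp_in_def)

text \<open>Sums over exponents supported in \<open>S \<union> {i}\<close> are double sums over an exponent supported in \<open>S\<close> and
  the exponent of the new coordinate. Both existence and uniqueness of power series are inductions along
  this bijection.\<close>

lemma has_sum_supp_in_insert:
  assumes "i \<notin> S"
  shows "(f has_sum s) (supp_in (insert i S)) \<longleftrightarrow> ((\<lambda>(\<beta>, n). f (\<beta>(i := n))) has_sum s) (supp_in S \<times> UNIV)"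
  by (rule has_sum_reindex_bij_witness[of _ "\<lambda>(\<beta>, n). \<beta>(i := n)" "\<lambda>\<alpha>. (\<alpha>(i := 0), \<alpha> i)"])
    (use assms in \<open>auto simp: supp_in_def fun_eq_iff\<close>)

text \<open>Osgood's lemma by induction on the set \<open>S\<close> of coordinates already expanded. The coefficients are
  still functions of the remaining coordinates. In the step each of them is expanded in the new
  coordinate \<open>i\<close>; the new coefficients stay in the class by \<open>sep_holo_coeff_z\<close>, obey Cauchy's inequality
  in one more variable, and do not depend on the \<open>i\<close>-th coordinate. Cauchy's bounds make the double
  series absolutely convergent, so that the iterated sum is the sum over the larger exponent set.\<close>

lemma partial_polydisc_expansion:
  fixes R :: "'m::finite \<Rightarrow> real" and S :: "'m set"
  assumes "finite S"
    and R: "\<And>i. R i > 0" and f: "sep_holo f (polydisc R)" and B: "\<And>w. w \<in> polydisc R \<Longrightarrow> norm (f w) \<le> B"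
  shows "\<exists>c. (\<forall>\<alpha>\<in>supp_in S. sep_holo (c \<alpha>) (polydisc R) \<and>
               (\<forall>w\<in>polydisc R. norm (c \<alpha> w) \<le> B / (\<Prod>i\<in>UNIV. R i ^ \<alpha> i)) \<and>
               (\<forall>w w'. (\<forall>j. j \<notin> S \<longrightarrow> w $ j = w' $ j) \<longrightarrow> c \<alpha> w = c \<alpha> w')) \<and>
             (\<forall>w\<in>polydisc R. ((\<lambda>\<alpha>. c \<alpha> w * mpow w \<alpha>) has_sum f w) (supp_in S))"
  using assms(1)
proof (induction S rule: finite_induct)
  case empty
  show ?case
  proof (intro exI[of _ "\<lambda>_. f"] conjI ballI allI impI)
    fix w show "((\<lambda>\<alpha>. f w * mpow w \<alpha>) has_sum f w) (supp_in {})"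
      by (auto simp: mpow_def intro!: has_sum_finiteI)
  next
    fix w w' :: "complex ^ 'm" assume "\<forall>j. j \<notin> {} \<longrightarrow> w $ j = w' $ j"
    then show "f w = f w'" by (metis empty_iff vec_eq_iff)
  qed (use f B in auto)
next
  case (insert i S)
  from insert.IH obtain c where c:
    "(\<forall>\<alpha>\<in>supp_in S. sep_holo (c \<alpha>) (polydisc R) \<and>
       (\<forall>w\<in>polydisc R. norm (c \<alpha> w) \<le> B / (\<Prod>i\<in>UNIV. R i ^ \<alpha> i)) \<and>
       (\<forall>w w'. (\<forall>j. j \<notin> S \<longrightarrow> w $ j = w' $ j) \<longrightarrow> c \<alpha> w = c \<alpha> w')) \<and>
     (\<forall>w\<in>polydisc R. ((\<lambda>\<alpha>. c \<alpha> w * mpow w \<alpha>) has_sum f w) (supp_in S))"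
    by (rule exE)
  from c have c_holo: "\<alpha> \<in> supp_in S \<Longrightarrow> sep_holo (c \<alpha>) (polydisc R)" for \<alpha> by simp
  from c have c_bound: "\<alpha> \<in> supp_in S \<Longrightarrow> w \<in> polydisc R \<Longrightarrow> norm (c \<alpha> w) \<le> B / (\<Prod>i\<in>UNIV. R i ^ \<alpha> i)" for \<alpha> w
    by simp
  from c have c_indep: "\<alpha> \<in> supp_in S \<Longrightarrow> (\<And>j. j \<notin> S \<Longrightarrow> w $ j = w' $ j) \<Longrightarrow> c \<alpha> w = c \<alpha> w'" for \<alpha> w w'
    by blast
  from c have c_sum: "w \<in> polydisc R \<Longrightarrow> ((\<lambda>\<alpha>. c \<alpha> w * mpow w \<alpha>) has_sum f w) (supp_in S)" for w
    by simp
  \<comment> \<open>The coefficient of \<open>w\<^sub>i\<close> to the power \<open>\<alpha> i\<close> in the coefficient function of the remaining exponent.\<close>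
  define d where "d \<alpha> w = coeff_z (\<alpha> i) (\<lambda>x. c (\<alpha>(i := 0)) (upd w i x))" for \<alpha> w
  have drop: "\<alpha>(i := 0) \<in> supp_in S" if "\<alpha> \<in> supp_in (insert i S)" for \<alpha> :: "'m \<Rightarrow> nat"
    using that by (auto simp: supp_in_def)
  have slice: "(\<lambda>x. c \<alpha> (upd w i x)) holomorphic_on ball 0 (R i)" if "\<alpha> \<in> supp_in S" "w \<in> polydisc R" for \<alpha> w
    using that by (intro sep_holo_slice[OF c_holo] upd_in_polydisc) auto
  have d_bound: "norm (d \<alpha> w) \<le> B / (\<Prod>i\<in>UNIV. R i ^ \<alpha> i)"
    if \<alpha>: "\<alpha> \<in> supp_in (insert i S)" and w: "w \<in> polydisc R" for \<alpha> w
  proof -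
    have "norm (d \<alpha> w) \<le> B / (\<Prod>j\<in>UNIV. R j ^ (\<alpha>(i := 0)) j) / R i ^ \<alpha> i"
      unfolding d_def using w
      by (intro coeff_z_bound_open slice drop \<alpha> R c_bound upd_in_polydisc) auto
    also have "\<dots> = B / (\<Prod>i\<in>UNIV. R i ^ \<alpha> i)"
      by (subst prod_power_upd[of R \<alpha> i]) (simp add: mult.commute)
    finally show ?thesis .
  qed
  show ?case
  proof (intro exI[of _ d] conjI ballI allI impI)
    fix \<alpha> assume \<alpha>: "\<alpha> \<in> supp_in (insert i S)"
    show "sep_holo (d \<alpha>) (polydisc R)"
      unfolding d_def
      by (rule sep_holo_coeff_z[OF joint_holo_coordinate[OF c_holo[OF drop[OF \<alpha>]]]])
        (use R in \<open>auto intro: open_polydisc\<close>)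
    show "norm (d \<alpha> w) \<le> B / (\<Prod>i\<in>UNIV. R i ^ \<alpha> i)" if "w \<in> polydisc R" for w
      using d_bound[OF \<alpha> that] .
    show "d \<alpha> w = d \<alpha> w'" if "\<forall>j. j \<notin> insert i S \<longrightarrow> w $ j = w' $ j" for w w'
    proof -
      have "c (\<alpha>(i := 0)) (upd w i x) = c (\<alpha>(i := 0)) (upd w' i x)" for x
        by (rule c_indep[OF drop[OF \<alpha>]]) (use that in auto)
      then show ?thesis by (simp add: d_def)
    qed
  next
    fix w assume w: "w \<in> polydisc R"
    have "(\<lambda>\<alpha>. norm (d \<alpha> w * mpow w \<alpha>)) summable_on supp_in (insert i S)"
      by (rule power_terms_norm_summable[OF w]) (rule d_bound[OF _ w])
    then have "(\<lambda>\<alpha>. d \<alpha> w * mpow w \<alpha>) summable_on supp_in (insert i S)"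
      by (rule abs_summable_summable)
    then obtain s where s: "((\<lambda>\<alpha>. d \<alpha> w * mpow w \<alpha>) has_sum s) (supp_in (insert i S))"
      by (auto simp: summable_on_def)
    then have pairs: "((\<lambda>(\<beta>, n). d (\<beta>(i := n)) w * mpow w (\<beta>(i := n))) has_sum s) (supp_in S \<times> UNIV)"
      using insert by (simp add: has_sum_supp_in_insert)
    have row: "((\<lambda>n. d (\<beta>(i := n)) w * mpow w (\<beta>(i := n))) has_sum c \<beta> w * mpow w \<beta>) UNIV"
      if \<beta>: "\<beta> \<in> supp_in S" for \<beta>
    proof -
      have \<beta>i: "\<beta> i = 0" using \<beta> insert by (auto simp: supp_in_def)
      then have \<beta>0: "\<beta>(i := 0) = \<beta>" by auto
      let ?g = "\<lambda>x. c \<beta> (upd w i x)"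
      have wi: "norm (w $ i) < R i" using w by (auto simp: polydisc_def)
      have row_eq: "d (\<beta>(i := n)) w * mpow w (\<beta>(i := n)) = coeff_z n ?g * (w $ i) ^ n * mpow w \<beta>" for n
        using mpow_fun_upd[where \<beta>=\<beta> and i=i and w=w and x="w $ i" and n=n, OF \<beta>i] by (simp add: d_def \<beta>0)
      have "(\<lambda>n. coeff_z n ?g * (w $ i) ^ n * mpow w \<beta>) sums (?g (w $ i) * mpow w \<beta>)"
        using slice[OF \<beta> w] wi by (intro sums_mult2 coeff_z_sums) auto
      moreover have "(\<lambda>n. coeff_z n ?g * (w $ i) ^ n * mpow w \<beta>) summable_on UNIV"
      proof -
        have "(\<lambda>y. (\<lambda>(\<beta>, n). d (\<beta>(i := n)) w * mpow w (\<beta>(i := n))) (\<beta>, y)) summable_on UNIV"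
          using summable_on_SigmaD1[of "\<lambda>\<beta> n. d (\<beta>(i := n)) w * mpow w (\<beta>(i := n))" "supp_in S" "\<lambda>_. UNIV" \<beta>]
            pairs \<beta> by (auto simp: summable_on_def)
        then show ?thesis by (simp add: row_eq)
      qed
      ultimately show ?thesis
        unfolding row_eq by (metis has_sum_imp_sums has_sum_infsum sums_unique2 upd_same)
    qed
    have "((\<lambda>\<beta>. c \<beta> w * mpow w \<beta>) has_sum s) (supp_in S)"
      by (rule has_sum_SigmaD[OF pairs]) (use row in auto)
    with c_sum[OF w] have "s = f w" by (metis has_sum_unique)
    with s show "((\<lambda>\<alpha>. d \<alpha> w * mpow w \<alpha>) has_sum f w) (supp_in (insert i S))" by simp
  qed
qed

theorem polydisc_power_series:
  fixes R :: "'m::finite \<Rightarrow> real"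
  assumes R: "\<And>i. R i > 0" and f: "sep_holo f (polydisc R)" and B: "\<And>w. w \<in> polydisc R \<Longrightarrow> norm (f w) \<le> B"
  obtains c where "\<And>\<alpha>. norm (c \<alpha>) \<le> B / (\<Prod>i\<in>UNIV. R i ^ \<alpha> i)"
    "\<And>w. w \<in> polydisc R \<Longrightarrow> ((\<lambda>\<alpha>. c \<alpha> * mpow w \<alpha>) has_sum f w) UNIV"
proof -
  have fin: "finite (UNIV :: 'm set)" by simp
  from partial_polydisc_expansion[OF fin assms] obtain c where
    "(\<forall>\<alpha>\<in>supp_in UNIV. sep_holo (c \<alpha>) (polydisc R) \<and>
       (\<forall>w\<in>polydisc R. norm (c \<alpha> w) \<le> B / (\<Prod>i\<in>UNIV. R i ^ \<alpha> i)) \<and>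
       (\<forall>w w'. (\<forall>j. j \<notin> UNIV \<longrightarrow> w $ j = w' $ j) \<longrightarrow> c \<alpha> w = c \<alpha> w')) \<and>
     (\<forall>w\<in>polydisc R. ((\<lambda>\<alpha>. c \<alpha> w * mpow w \<alpha>) has_sum f w) (supp_in UNIV))"
    by (rule exE)
  then have c: "w \<in> polydisc R \<Longrightarrow> norm (c \<alpha> w) \<le> B / (\<Prod>i\<in>UNIV. R i ^ \<alpha> i)" "c \<alpha> w = c \<alpha> w'"
      "w \<in> polydisc R \<Longrightarrow> ((\<lambda>\<alpha>. c \<alpha> w * mpow w \<alpha>) has_sum f w) UNIV" for \<alpha> w w'
    by simp_all
  have 0: "0 \<in> polydisc R" using R by (auto simp: polydisc_def)
  show thesis
  proof (rule that[of "\<lambda>\<alpha>. c \<alpha> 0"])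
    show "norm (c \<alpha> 0) \<le> B / (\<Prod>i\<in>UNIV. R i ^ \<alpha> i)" for \<alpha> using c(1) 0 by blast
    fix w assume "w \<in> polydisc R"
    from c(3)[OF this] show "((\<lambda>\<alpha>. c \<alpha> 0 * mpow w \<alpha>) has_sum f w) UNIV"
      by (subst c(2)[of _ 0 w])
  qed
qed

text \<open>Induction on the coordinates: for fixed values of the others, the series is a power series in the
  \<open>i\<close>-th coordinate with sum zero, so that each of its coefficients vanishes, and these are power series
  in fewer coordinates.\<close>

lemma zero_power_series_unique:
  fixes c :: "('m::finite \<Rightarrow> nat) \<Rightarrow> complex" and S :: "'m set"
  assumes fin: "finite S" and r: "r > 0" and sum: "\<And>w. w \<in> polydisc (\<lambda>_. r) \<Longrightarrow> ((\<lambda>\<alpha>. c \<alpha> * mpow w \<alpha>) has_sum 0) (supp_in S)"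
    and "\<alpha> \<in> supp_in S"
  shows "c \<alpha> = 0"
  using fin sum \<open>\<alpha> \<in> supp_in S\<close>
proof (induction S arbitrary: c \<alpha> rule: finite_induct)
  case (empty c \<alpha>)
  have "0 \<in> polydisc (\<lambda>_. r)" using r by (auto simp: polydisc_def)
  from empty(1)[OF this] have "((\<lambda>\<alpha>. c \<alpha> * mpow 0 \<alpha>) has_sum 0) {\<lambda>_. 0}" by simp
  then have "c (\<lambda>_. 0) = 0" by (simp add: has_sum_finite_iff mpow_def)
  then show ?case using empty by simp
next
  case (insert i S c \<alpha>)
  have "c (\<beta>(i := n)) = 0" if \<beta>: "\<beta> \<in> supp_in S" for \<beta> n
  proof (rule insert.IH[OF _ \<beta>])
    fix w :: "complex ^ 'm" assume w: "w \<in> polydisc (\<lambda>_. r)"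
    define g where "g n = (\<Sum>\<^sub>\<infinity>\<beta>\<in>supp_in S. c (\<beta>(i := n)) * mpow w \<beta>)" for n
    have pairs: "((\<lambda>(n, \<beta>). c (\<beta>(i := n)) * (x ^ n * mpow w \<beta>)) has_sum 0) (UNIV \<times> supp_in S)" if "norm x < r" for x
    proof -
      have "((\<lambda>\<alpha>. c \<alpha> * mpow (upd w i x) \<alpha>) has_sum 0) (supp_in (insert i S))"
        by (rule insert.prems(1)) (use w that in \<open>auto intro: upd_in_polydisc\<close>)
      then have "((\<lambda>(\<beta>, n). c (\<beta>(i := n)) * mpow (upd w i x) (\<beta>(i := n))) has_sum 0) (supp_in S \<times> UNIV)"
        using insert by (simp add: has_sum_supp_in_insert)
      then have "((\<lambda>(\<beta>, n). c (\<beta>(i := n)) * (x ^ n * mpow w \<beta>)) has_sum 0) (supp_in S \<times> UNIV)"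
        by (rule has_sum_cong[THEN iffD1, rotated]) (use insert.hyps in \<open>auto simp: supp_in_def mpow_fun_upd\<close>)
      then show ?thesis
        by (rule iffD1[OF has_sum_reindex_bij_witness[of _ prod.swap prod.swap], rotated -1]) auto
    qed
    \<comment> \<open>Summability of a row is read off at one nonzero value of the coordinate, here \<open>r / 2\<close>.\<close>
    have g: "((\<lambda>\<beta>. c (\<beta>(i := n)) * mpow w \<beta>) has_sum g n) (supp_in S)" for n
    proof -
      let ?x = "complex_of_real (r / 2)"
      have x: "norm ?x < r" "?x \<noteq> 0" using r by auto
      have "(\<lambda>\<beta>. c (\<beta>(i := n)) * (?x ^ n * mpow w \<beta>)) summable_on supp_in S"
        using summable_on_SigmaD1[of "\<lambda>n \<beta>. c (\<beta>(i := n)) * (?x ^ n * mpow w \<beta>)" UNIV "\<lambda>_. supp_in S" n]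
          pairs[OF x(1)] by (auto simp: summable_on_def)
      from summable_on_cmult_right[OF this, of "1 / ?x ^ n"]
      have "(\<lambda>\<beta>. c (\<beta>(i := n)) * mpow w \<beta>) summable_on supp_in S" using x(2) by (simp add: mult_ac)
      then show ?thesis unfolding g_def by (rule has_sum_infsum)
    qed
    have "coeff_z n (\<lambda>_. 0) = g n" for n
    proof (rule coeff_z_eqI[OF r])
      fix x :: complex assume x: "norm x < r"
      have "((\<lambda>n. g n * x ^ n) has_sum 0) UNIV"
      proof (rule has_sum_SigmaD[OF pairs[OF x]])
        fix n show "((\<lambda>\<beta>. case (n, \<beta>) of (n, \<beta>) \<Rightarrow> c (\<beta>(i := n)) * (x ^ n * mpow w \<beta>)) has_sum g n * x ^ n) (supp_in S)"
          using has_sum_cmult_left[OF g[of n], of "x ^ n"] by (simp add: mult_ac)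
      qed
      then show "(\<lambda>n. g n * x ^ n) sums 0" by (rule has_sum_imp_sums)
    qed
    moreover have "coeff_z n (\<lambda>_. 0) = 0" for n
      by (rule coeff_z_eqI[of 1 "\<lambda>_. 0"]) auto
    ultimately show "((\<lambda>\<beta>. c (\<beta>(i := n)) * mpow w \<beta>) has_sum 0) (supp_in S)"
      using g[of n] by simp
  qed
  from this[of "\<alpha>(i := 0)" "\<alpha> i"] show ?case using insert.prems(2) by (auto simp: supp_in_def)
qed

lemma has_power_series_w_unique:
  assumes "has_power_series_w f 0 c" "has_power_series_w f 0 d"
  shows "c = d"
proof
  fix \<alpha>
  obtain r1 r2 where r: "r1 > 0" "r2 > 0"
    and s: "\<And>w. (\<forall>i. norm (w $ i) < r1) \<Longrightarrow> ((\<lambda>\<alpha>. c \<alpha> * mpow w \<alpha>) has_sum f w) UNIV"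
      "\<And>w. (\<forall>i. norm (w $ i) < r2) \<Longrightarrow> ((\<lambda>\<alpha>. d \<alpha> * mpow w \<alpha>) has_sum f w) UNIV"
    using assms unfolding has_power_series_w_def by auto
  have "c \<alpha> - d \<alpha> = 0"
  proof (rule zero_power_series_unique[of UNIV "min r1 r2" "\<lambda>\<alpha>. c \<alpha> - d \<alpha>"])
    fix w :: "complex ^ 'a" assume w: "w \<in> polydisc (\<lambda>_. min r1 r2)"
    have "((\<lambda>\<alpha>. c \<alpha> * mpow w \<alpha> + - (d \<alpha> * mpow w \<alpha>)) has_sum f w + - f w) UNIV"
      using w by (intro has_sum_add has_sum_uminusI s) (auto simp: polydisc_def)
    then show "((\<lambda>\<alpha>. (c \<alpha> - d \<alpha>) * mpow w \<alpha>) has_sum 0) (supp_in UNIV)" by (simp add: left_diff_distrib)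
  qed (use r in auto)
  then show "c \<alpha> = d \<alpha>" by simp
qed

lemma coeff_w_eqI: "has_power_series_w f 0 c \<Longrightarrow> coeff_w \<alpha> f = c \<alpha>"
  unfolding coeff_w_def using has_power_series_w_unique by (subst the_equality[of _ c]) blast+

text \<open>Grouping a power series in \<open>(z, w)\<close> by powers of \<open>z\<close> shows that taking the coefficient of \<open>z\<^sup>n\<close>
  first and the one of \<open>w\<^sup>\<alpha>\<close> afterwards gives the joint coefficient.\<close>

lemma has_power_series_zw_slice:
  assumes "has_power_series_zw f 0 0 c"
  shows "has_power_series_w (\<lambda>w. coeff_z n (\<lambda>z. f z w)) 0 (c n)"
proof -
  obtain r where r: "r > 0" and s: "\<And>z w. norm z < r \<Longrightarrow> (\<forall>i. norm (w $ i) < r) \<Longrightarrow>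
       ((\<lambda>(n, \<alpha>). c n \<alpha> * z ^ n * mpow w \<alpha>) has_sum f z w) UNIV"
    using assms unfolding has_power_series_zw_def by auto
  show ?thesis
    unfolding has_power_series_w_def
  proof (intro exI[of _ r] conjI allI impI)
    fix w :: "complex ^ 'a" assume "\<forall>i. norm (w $ i - 0 $ i) < r"
    then have w: "\<forall>i. norm (w $ i) < r" by simp
    define g where "g n = (\<Sum>\<^sub>\<infinity>\<alpha>. c n \<alpha> * mpow w \<alpha>)" for n
    \<comment> \<open>A nonzero value of \<open>z\<close> shows that each row is summable.\<close>
    have g: "((\<lambda>\<alpha>. c n \<alpha> * mpow w \<alpha>) has_sum g n) UNIV" for n
    proof -
      let ?x = "complex_of_real (r / 2)"
      have x: "norm ?x < r" "?x \<noteq> 0" using r by auto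
      have "(\<lambda>\<alpha>. c n \<alpha> * ?x ^ n * mpow w \<alpha>) summable_on UNIV"
        using summable_on_SigmaD1[of "\<lambda>n \<alpha>. c n \<alpha> * ?x ^ n * mpow w \<alpha>" UNIV "\<lambda>_. UNIV" n]
          s[OF x(1) w] by (auto simp: summable_on_def)
      from summable_on_cmult_right[OF this, of "1 / ?x ^ n"]
      have "(\<lambda>\<alpha>. c n \<alpha> * mpow w \<alpha>) summable_on UNIV" using x(2) by (simp add: mult_ac)
      then show ?thesis unfolding g_def by (rule has_sum_infsum)
    qed
    have "coeff_z n (\<lambda>z. f z w) = g n"
    proof (rule coeff_z_eqI[OF r])
      fix x :: complex assume x: "norm x < r"
      have "((\<lambda>n. g n * x ^ n) has_sum f x w) UNIV"
      proof (rule has_sum_SigmaD)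
        show "((\<lambda>(n, \<alpha>). c n \<alpha> * x ^ n * mpow w \<alpha>) has_sum f x w) (Sigma UNIV (\<lambda>_. UNIV))"
          using s[OF x w] by simp
        fix n show "((\<lambda>\<alpha>. case (n, \<alpha>) of (n, \<alpha>) \<Rightarrow> c n \<alpha> * x ^ n * mpow w \<alpha>) has_sum g n * x ^ n) UNIV"
          using has_sum_cmult_left[OF g[of n], of "x ^ n"] by (simp add: mult_ac)
      qed
      then show "(\<lambda>n. g n * x ^ n) sums f x w" by (rule has_sum_imp_sums)
    qed
    then show "((\<lambda>\<alpha>. c n \<alpha> * mpow (w - 0) \<alpha>) has_sum coeff_z n (\<lambda>z. f z w)) UNIV"
      using g[of n] by simp
  qed (use r in auto)
qed

lemma coeff_zw_eq_coeff_w: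
  assumes "has_power_series_zw f 0 0 c"
  shows "coeff_zw n \<alpha> f = coeff_w \<alpha> (\<lambda>w. coeff_z n (\<lambda>z. f z w))"
proof -
  have "d = c" if "has_power_series_zw f 0 0 d" for d
  proof
    fix n
    show "d n = c n"
      by (rule has_power_series_w_unique[OF has_power_series_zw_slice[OF that] has_power_series_zw_slice[OF assms]])
  qed
  then have "(THE c. has_power_series_zw f 0 0 c) = c"
    by (intro the_equality assms)
  then show ?thesis
    unfolding coeff_zw_def by (simp only: coeff_w_eqI[OF has_power_series_zw_slice[OF assms, of n], of \<alpha>])
qed


section \<open>Power series and holomorphy\<close>

text \<open>On a smaller closed polydisc the partial sums converge uniformly (the majorant is the series of
  absolute values at a corner), so continuity and holomorphy in each variable pass from the
  partial sums to \<open>F\<close>. It suffices to draw the conclusion at the centre of the expansion.\<close>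

lemma power_series_zw_regular:
  fixes b :: "complex ^ 'm::finite"
  assumes "has_power_series_zw F a b c"
  shows "isCont (\<lambda>(z, w). F z w) (a, b)" "(\<lambda>z. F z b) field_differentiable at a"
    "(\<lambda>x. F a (upd b i x)) field_differentiable at (b $ i)"
proof -
  obtain r where r: "r > 0" and s: "\<And>z w. norm (z - a) < r \<Longrightarrow> (\<forall>i. norm (w $ i - b $ i) < r) \<Longrightarrow>
       ((\<lambda>(n, \<alpha>). c n \<alpha> * (z - a) ^ n * mpow (w - b) \<alpha>) has_sum F z w) UNIV"
    using assms unfolding has_power_series_zw_def by auto
  define \<rho> where "\<rho> = r / 2"
  have \<rho>: "0 < \<rho>" "\<rho> < r" using r by (auto simp: \<rho>_def)
  define K where "K = cball a \<rho> \<times> {w. \<forall>i. norm (w $ i - b $ i) \<le> \<rho>}"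
  define M where "M = (\<lambda>(n, \<alpha>). norm (c n \<alpha> * of_real \<rho> ^ n * mpow (\<chi> i. of_real \<rho>) \<alpha>))"
  have M: "M summable_on UNIV"
  proof -
    have "((\<lambda>(n, \<alpha>). c n \<alpha> * ((a + of_real \<rho>) - a) ^ n * mpow ((b + (\<chi> i. of_real \<rho>)) - b) \<alpha>)
        has_sum F (a + of_real \<rho>) (b + (\<chi> i. of_real \<rho>))) UNIV"
      by (rule s) (use \<rho> in auto)
    then have "(\<lambda>(n, \<alpha>). c n \<alpha> * of_real \<rho> ^ n * mpow (\<chi> i. of_real \<rho>) \<alpha>) summable_on UNIV"
      by (auto simp: summable_on_def)
    then show ?thesis
      unfolding summable_on_iff_abs_summable_on_complex by (simp add: M_def case_prod_unfold)
  qed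
  let ?t = "\<lambda>(n, \<alpha>) (z, w). c n \<alpha> * (z - a) ^ n * mpow (w - b) \<alpha>"
  have lim: "uniform_limit K (\<lambda>X p. \<Sum>x\<in>X. ?t x p) (\<lambda>(z, w). F z w) (finite_subsets_at_top UNIV)"
  proof (rule Weierstrass_m_test_general'[OF _ _ M])
    fix x :: "nat \<times> ('m \<Rightarrow> nat)" and p assume p: "p \<in> K"
    obtain n \<alpha> z w where [simp]: "x = (n, \<alpha>)" "p = (z, w)" by (cases x, cases p)
    have zw: "norm (z - a) \<le> \<rho>" "\<And>i. norm (w $ i - b $ i) \<le> \<rho>"
      using p by (auto simp: K_def dist_norm norm_minus_commute)
    show "norm (?t x p) \<le> M x"
      using zw \<rho> by (auto simp: M_def norm_mult norm_power norm_mpow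
        intro!: mult_mono power_mono prod_mono prod_nonneg)
  next
    fix p assume p: "p \<in> K"
    obtain z w where [simp]: "p = (z, w)" by (cases p)
    have "norm (z - a) < r" "\<And>i. norm (w $ i - b $ i) < r"
      using p \<rho> by (auto simp: K_def dist_norm norm_minus_commute intro: le_less_trans)
    then show "((\<lambda>x. ?t x p) has_sum (case p of (z, w) \<Rightarrow> F z w)) UNIV"
      using s[of z w] by (simp add: case_prod_unfold)
  qed
  have sub: "ball a \<rho> \<times> ball b \<rho> \<subseteq> K"
  proof
    fix p assume "p \<in> ball a \<rho> \<times> ball b \<rho>"
    then have "norm (snd p $ i - b $ i) \<le> \<rho>" for i
      using Finite_Cartesian_Product.norm_nth_le[of "snd p - b" i] by (auto simp: dist_norm norm_minus_commute)
    then show "p \<in> K" using \<open>p \<in> _\<close> by (auto simp: K_def)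
  qed
  have "continuous_on K (\<lambda>(z, w). F z w)"
  proof (rule uniform_limit_theorem[OF _ lim])
    show "\<forall>\<^sub>F X in finite_subsets_at_top UNIV. continuous_on K (\<lambda>p. \<Sum>x\<in>X. ?t x p)"
      by (intro always_eventually allI) (auto simp: case_prod_unfold mpow_def intro!: continuous_intros)
  qed auto
  then have "continuous_on (ball a \<rho> \<times> ball b \<rho>) (\<lambda>(z, w). F z w)"
    using sub by (rule continuous_on_subset)
  then show "isCont (\<lambda>(z, w). F z w) (a, b)"
    using \<rho> by (subst (asm) continuous_on_eq_continuous_at) (auto intro: open_Times)
  have "uniform_limit (cball a \<rho>) (\<lambda>X z. \<Sum>x\<in>X. ?t x (z, b)) (\<lambda>z. case (z, b) of (z, w) \<Rightarrow> F z w) (finite_subsets_at_top UNIV)"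
    by (rule uniform_limit_compose'[OF lim]) (use \<rho> in \<open>auto simp: K_def\<close>)
  then have "(\<lambda>z. case (z, b) of (z, w) \<Rightarrow> F z w) holomorphic_on ball a \<rho>"
  proof (rule holomorphic_uniform_limit[rotated])
    show "\<forall>\<^sub>F X in finite_subsets_at_top UNIV. continuous_on (cball a \<rho>) (\<lambda>z. \<Sum>x\<in>X. ?t x (z, b)) \<and>
        (\<lambda>z. \<Sum>x\<in>X. ?t x (z, b)) holomorphic_on ball a \<rho>"
      by (intro always_eventually allI conjI) (auto simp: case_prod_unfold intro!: continuous_intros holomorphic_intros)
  qed auto
  then show "(\<lambda>z. F z b) field_differentiable at a"
    using \<rho> by (auto intro: holomorphic_on_imp_differentiable_at)
  have "uniform_limit (cball (b $ i) \<rho>) (\<lambda>X x. \<Sum>y\<in>X. ?t y (a, upd b i x)) (\<lambda>x. case (a, upd b i x) of (z, w) \<Rightarrow> F z w) (finite_subsets_at_top UNIV)"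
    by (rule uniform_limit_compose'[OF lim]) (use \<rho> in \<open>auto simp: K_def dist_norm norm_minus_commute\<close>)
  then have "(\<lambda>x. case (a, upd b i x) of (z, w) \<Rightarrow> F z w) holomorphic_on ball (b $ i) \<rho>"
  proof (rule holomorphic_uniform_limit[rotated])
    have "(\<lambda>x. (upd b i x - b) $ j) holomorphic_on UNIV" for j
      by (cases "j = i") (auto intro!: holomorphic_intros)
    then have "(\<lambda>x. \<Sum>y\<in>X. ?t y (a, upd b i x)) holomorphic_on UNIV" for X
      unfolding case_prod_unfold mpow_def by (intro holomorphic_intros) auto
    then show "\<forall>\<^sub>F X in finite_subsets_at_top UNIV. continuous_on (cball (b $ i) \<rho>) (\<lambda>x. \<Sum>y\<in>X. ?t y (a, upd b i x)) \<and>
        (\<lambda>x. \<Sum>y\<in>X. ?t y (a, upd b i x)) holomorphic_on ball (b $ i) \<rho>"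
      by (intro always_eventually allI conjI) (blast intro: holomorphic_on_imp_continuous_on holomorphic_on_subset)+
  qed auto
  then show "(\<lambda>x. F a (upd b i x)) field_differentiable at (b $ i)"
    using \<rho> by (auto intro: holomorphic_on_imp_differentiable_at)
qed

lemma analytic_zw_on_imp_joint_holo:
  assumes "analytic_zw_on F (A \<times> V)"
  shows "joint_holo F A V"
proof -
  have *: "isCont (\<lambda>(z, w). F z w) (a, b)" "(\<lambda>z. F z b) field_differentiable at a"
      "(\<lambda>x. F a (upd b i x)) field_differentiable at (b $ i)" if "a \<in> A" "b \<in> V" for a b i
    using assms that power_series_zw_regular[of F a b] unfolding analytic_zw_on_def by blast+
  have cont: "continuous_on (A \<times> V) (\<lambda>(z, w). F z w)"
    by (rule continuous_at_imp_continuous_on) (use *(1) in auto)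
  show ?thesis
    unfolding joint_holo_def
  proof (intro conjI ballI cont)
    fix w assume "w \<in> V"
    then show "(\<lambda>z. F z w) holomorphic_on A"
      using *(2) by (auto simp: holomorphic_on_def intro: field_differentiable_at_within)
  next
    fix z assume z: "z \<in> A"
    show "sep_holo (F z) V"
    proof (rule sep_holoI)
      have "continuous_on V (\<lambda>w. (\<lambda>(z, w). F z w) (z, w))"
        by (rule continuous_on_compose2[OF cont]) (use z in \<open>auto intro!: continuous_intros\<close>)
      then show "continuous_on V (F z)" by simp
    qed (use * z in auto)
  qed
qed

lemma norm_le_sum_components: "norm (w :: complex ^ 'm::finite) \<le> (\<Sum>i\<in>UNIV. norm (w $ i))"
  unfolding norm_vec_def by (rule L2_set_le_sum) auto

text \<open>Power series are summed on polydiscs, whereas open sets of \<^typ>\<open>complex ^ 'm\<close> are described by the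
  Euclidean norm.\<close>

lemma closed_box_in_open:
  fixes b :: "complex ^ 'm::finite"
  assumes "open V" "b \<in> V"
  obtains r where "r > 0" "\<And>w. (\<And>i. norm (w $ i - b $ i) \<le> r) \<Longrightarrow> w \<in> V"
proof -
  obtain e where e: "e > 0" "cball b e \<subseteq> V" using open_contains_cball_eq[OF assms(1)] assms(2) by metis
  show thesis
  proof (rule that[of "e / CARD('m)"])
    fix w assume w: "\<And>i. norm (w $ i - b $ i) \<le> e / CARD('m)"
    have "norm (w - b) \<le> (\<Sum>i\<in>UNIV. norm ((w - b) $ i))" by (rule norm_le_sum_components)
    also have "\<dots> \<le> (\<Sum>i\<in>(UNIV::'m set). e / CARD('m))" by (intro sum_mono) (use w in simp)
    finally have "w \<in> cball b e" by (simp add: dist_norm norm_minus_commute)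
    then show "w \<in> V" using e by blast
  qed (use e in auto)
qed

lemma compact_closed_polydisc: "compact {w :: complex ^ 'm::finite. \<forall>i. norm (w $ i) \<le> R i}"
  unfolding compact_eq_bounded_closed
proof
  have "norm w \<le> (\<Sum>i\<in>UNIV. R i)" if "\<forall>i. norm (w $ i) \<le> R i" for w :: "complex ^ 'm"
    by (rule order_trans[OF norm_le_sum_components sum_mono]) (use that in auto)
  then show "bounded {w :: complex ^ 'm. \<forall>i. norm (w $ i) \<le> R i}"
    unfolding bounded_iff by blast
  have "{w :: complex ^ 'm. \<forall>i. norm (w $ i) \<le> R i} = (\<Inter>i. {w. norm (w $ i) \<le> R i})" by auto
  then show "closed {w :: complex ^ 'm. \<forall>i. norm (w $ i) \<le> R i}"
    by (auto intro!: closed_INT closed_Collect_le continuous_intros)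
qed

lemma bounded_on_compact:
  fixes f :: "'a::topological_space \<Rightarrow> 'b::real_normed_vector"
  assumes "continuous_on K f" "compact K"
  obtains B where "\<forall>x\<in>K. norm (f x) \<le> B"
  using compact_imp_bounded[OF compact_continuous_image[OF assms]] unfolding bounded_iff by auto

lemma sep_holo_imp_analytic_w_on:
  assumes V: "open V" and f: "sep_holo f V"
  shows "analytic_w_on f V"
  unfolding analytic_w_on_def
proof
  fix b :: "complex ^ 'a" assume "b \<in> V"
  then obtain r where r: "r > 0" "\<And>w. (\<And>i. norm (w $ i - b $ i) \<le> r) \<Longrightarrow> w \<in> V"
    using closed_box_in_open[OF V] by blast
  let ?K = "{w :: complex ^ 'a. \<forall>i. norm (w $ i) \<le> r}"
  have K: "?K \<subseteq> {w. w + b \<in> V}" using r(2) by auto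
  have f': "sep_holo (\<lambda>w. f (w + b)) ?K"
    by (rule sep_holo_subset[OF sep_holo_translate[OF f] K])
  obtain B where B: "\<forall>w\<in>?K. norm (f (w + b)) \<le> B"
    by (rule bounded_on_compact[OF sep_holo_continuous[OF f'] compact_closed_polydisc])
  have sub: "polydisc (\<lambda>_. r) \<subseteq> ?K" by (auto simp: polydisc_def less_imp_le)
  obtain c where c: "\<And>w. w \<in> polydisc (\<lambda>_. r) \<Longrightarrow> ((\<lambda>\<alpha>. c \<alpha> * mpow w \<alpha>) has_sum f (w + b)) UNIV"
    by (rule polydisc_power_series[of "\<lambda>_. r" "\<lambda>w. f (w + b)" B, OF _ sep_holo_subset[OF f' sub]])
      (use B sub r(1) in auto)
  have "has_power_series_w f b c"
    unfolding has_power_series_w_def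
    using r(1) c[of "_ - b"] by (intro exI[of _ r]) (auto simp: polydisc_def)
  then show "\<exists>c. has_power_series_w f b c" by (rule exI[of _ c])
qed

lemma summable_on_times_nonneg:
  fixes f :: "'a \<Rightarrow> real" and g :: "'b \<Rightarrow> real"
  assumes "f summable_on A" "g summable_on B" "\<And>x. x \<in> A \<Longrightarrow> f x \<ge> 0" "\<And>y. y \<in> B \<Longrightarrow> g y \<ge> 0"
  shows "(\<lambda>(x, y). f x * g y) summable_on A \<times> B"
proof (rule summable_on_SigmaI)
  fix x show "((\<lambda>y. case (x, y) of (x, y) \<Rightarrow> f x * g y) has_sum f x * infsum g B) B"
    using assms(2) by (simp add: has_sum_cmult_right)
qed (use assms in \<open>auto intro: summable_on_cmult_left\<close>)

text \<open>Expand in \<open>z\<close> first, then expand the coefficients, which belong to the class by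
  \<open>sep_holo_coeff_z\<close>, in \<open>w\<close>. Cauchy's inequalities for both expansions dominate the double series by a
  product of geometric series.\<close>

lemma joint_holo_has_power_series_zw:
  fixes F :: "complex \<Rightarrow> complex ^ 'm::finite \<Rightarrow> complex"
  assumes F: "joint_holo F A V" and A: "open A" "0 \<in> A" and V: "open V" "0 \<in> V"
  shows "\<exists>c. has_power_series_zw F 0 0 c"
proof -
  obtain r1 where r1: "r1 > 0" "cball 0 r1 \<subseteq> A" using open_contains_cball_eq[OF A(1)] A(2) by metis
  obtain r2 where r2: "r2 > 0" "\<And>w. (\<And>i. norm (w $ i - 0 $ i) \<le> r2) \<Longrightarrow> w \<in> V"
    using closed_box_in_open[OF V] by blast
  define r where "r = min r1 r2"
  have r: "r > 0" using r1 r2 by (simp add: r_def)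
  let ?K = "{w :: complex ^ 'm. \<forall>i. norm (w $ i) \<le> r}"
  have sub: "cball 0 r \<subseteq> A" "?K \<subseteq> V" using r1 r2 by (auto simp: r_def)
  have pK: "polydisc (\<lambda>_. r) \<subseteq> ?K" by (auto simp: polydisc_def less_imp_le)
  then have pV: "polydisc (\<lambda>_. r) \<subseteq> V" using sub by blast
  have "continuous_on (cball 0 r \<times> ?K) (\<lambda>(z, w). F z w)"
    by (rule continuous_on_subset[of "A \<times> V"]) (use F sub in \<open>auto simp: joint_holo_def\<close>)
  then obtain B where B: "\<forall>x\<in>cball 0 r \<times> ?K. norm (case x of (z, w) \<Rightarrow> F z w) \<le> B"
    by (rule bounded_on_compact[OF _ compact_Times[OF compact_cball compact_closed_polydisc]])
  have B: "norm (F z w) \<le> B" if "norm z \<le> r" "w \<in> polydisc (\<lambda>_. r)" for z w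
    using bspec[OF B, of "(z, w)"] that pK by auto
  define d where "d n w = coeff_z n (\<lambda>z. F z w)" for n w
  have holF: "(\<lambda>z. F z w) holomorphic_on ball 0 r" if "w \<in> polydisc (\<lambda>_. r)" for w
  proof (rule holomorphic_on_subset)
    show "(\<lambda>z. F z w) holomorphic_on A" using F that pV by (auto simp: joint_holo_def)
    show "ball 0 r \<subseteq> A" using sub by auto
  qed
  have d_bound: "norm (d n w) \<le> B / r ^ n" if "w \<in> polydisc (\<lambda>_. r)" for n w
    unfolding d_def by (rule coeff_z_bound_open[OF holF[OF that] r]) (use that in \<open>auto intro: B\<close>)
  have d_holo: "sep_holo (d n) (polydisc (\<lambda>_. r))" for n
    using sep_holo_subset[OF sep_holo_coeff_z[OF F A(1) V(1) A(2)] pV] by (simp add: d_def[abs_def])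
  have "\<exists>c. (\<forall>\<alpha>. norm (c \<alpha>) \<le> B / r ^ n / (\<Prod>i\<in>(UNIV::'m set). r ^ \<alpha> i)) \<and>
      (\<forall>w\<in>polydisc (\<lambda>_. r). ((\<lambda>\<alpha>. c \<alpha> * mpow w \<alpha>) has_sum d n w) UNIV)" for n
    by (rule polydisc_power_series[of "\<lambda>_. r" "d n" "B / r ^ n", OF _ d_holo d_bound]) (use r in auto)
  then obtain c where c_bound: "\<And>n \<alpha>. norm (c n \<alpha>) \<le> B / r ^ n / (\<Prod>i\<in>(UNIV::'m set). r ^ \<alpha> i)"
    and c_sum: "\<And>n w. w \<in> polydisc (\<lambda>_. r) \<Longrightarrow> ((\<lambda>\<alpha>. c n \<alpha> * mpow w \<alpha>) has_sum d n w) UNIV"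
    by metis
  have "has_power_series_zw F 0 0 c"
    unfolding has_power_series_zw_def
  proof (intro exI[of _ r] conjI allI impI)
    fix z :: complex and w :: "complex ^ 'm"
    assume "norm (z - 0) < r \<and> (\<forall>i. norm (w $ i - 0 $ i) < r)"
    then have z: "norm z < r" and w: "w \<in> polydisc (\<lambda>_. r)" by (auto simp: polydisc_def)
    define x where "x = norm z / r"
    have x: "0 \<le> x" "x < 1" using z r by (auto simp: x_def)
    have "(\<lambda>\<alpha>. \<Prod>i\<in>UNIV. (norm (w $ i) / r) ^ \<alpha> i) summable_on UNIV"
      using w r by (intro multi_geometric_summable) (auto simp: polydisc_def)
    moreover have geo: "(\<lambda>n. B * x ^ n) summable_on UNIV"
      using x by (intro summable_on_cmult_right summable_nonneg_imp_summable_on summable_geometric) auto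
    moreover have "B \<ge> 0" using B[of 0 w] w r by (auto intro: order_trans[OF norm_ge_zero])
    ultimately have "(\<lambda>(n, \<alpha>). (B * x ^ n) * (\<Prod>i\<in>UNIV. (norm (w $ i) / r) ^ \<alpha> i)) summable_on UNIV \<times> UNIV"
      using x r by (intro summable_on_times_nonneg) (auto intro!: prod_nonneg)
    then have "(\<lambda>p. norm (case p of (n, \<alpha>) \<Rightarrow> c n \<alpha> * z ^ n * mpow w \<alpha>)) summable_on UNIV \<times> UNIV"
    proof (rule summable_on_comparison_test)
      fix p :: "nat \<times> ('m \<Rightarrow> nat)"
      obtain n \<alpha> where [simp]: "p = (n, \<alpha>)" by (cases p)
      have "norm (c n \<alpha> * z ^ n * mpow w \<alpha>) \<le> B / r ^ n / (\<Prod>i\<in>UNIV. r ^ \<alpha> i) * norm z ^ n * (\<Prod>i\<in>UNIV. norm (w $ i) ^ \<alpha> i)"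
        unfolding norm_mult norm_mpow norm_power by (intro mult_right_mono c_bound prod_nonneg) auto
      also have "\<dots> = (B * x ^ n) * (\<Prod>i\<in>UNIV. (norm (w $ i) / r) ^ \<alpha> i)"
        by (simp add: x_def power_divide prod_dividef)
      finally show "norm (case p of (n, \<alpha>) \<Rightarrow> c n \<alpha> * z ^ n * mpow w \<alpha>) \<le>
          (case p of (n, \<alpha>) \<Rightarrow> (B * x ^ n) * (\<Prod>i\<in>UNIV. (norm (w $ i) / r) ^ \<alpha> i))" by simp
    qed auto
    then have sm: "(\<lambda>(n, \<alpha>). c n \<alpha> * z ^ n * mpow w \<alpha>) summable_on UNIV \<times> UNIV"
      by (rule abs_summable_summable)
    have "((\<lambda>n. d n w * z ^ n) has_sum F z w) UNIV"
    proof (rule norm_summable_imp_has_sum)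
      show "(\<lambda>n. d n w * z ^ n) sums F z w"
        unfolding d_def by (rule coeff_z_sums[OF holF[OF w] z])
      show "summable (\<lambda>n. norm (d n w * z ^ n))"
      proof (rule summable_comparison_test')
        show "summable (\<lambda>n. B * x ^ n)" using x by (intro summable_mult summable_geometric) auto
        fix n show "norm (norm (d n w * z ^ n)) \<le> B * x ^ n"
          using mult_right_mono[OF d_bound[OF w, of n], of "norm z ^ n"]
          by (simp add: norm_mult norm_power x_def power_divide)
      qed
    qed
    then have "((\<lambda>(n, \<alpha>). c n \<alpha> * z ^ n * mpow w \<alpha>) has_sum F z w) (UNIV \<times> UNIV)"
    proof (rule has_sum_SigmaI[rotated])
      fix n show "((\<lambda>\<alpha>. case (n, \<alpha>) of (n, \<alpha>) \<Rightarrow> c n \<alpha> * z ^ n * mpow w \<alpha>) has_sum d n w * z ^ n) UNIV"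
        using has_sum_cmult_left[OF c_sum[OF w, of n], of "z ^ n"] by (simp add: mult_ac)
    qed (use sm in auto)
    then show "((\<lambda>(n, \<alpha>). c n \<alpha> * (z - 0) ^ n * mpow (w - 0) \<alpha>) has_sum F z w) UNIV" by simp
  qed (use r in auto)
  then show ?thesis by (rule exI[of _ c])
qed

lemma has_power_series_w_add:
  assumes "has_power_series_w f 0 c" "has_power_series_w g 0 d"
  shows "has_power_series_w (\<lambda>w. f w + g w) 0 (\<lambda>\<alpha>. c \<alpha> + d \<alpha>)"
proof -
  obtain r1 r2 where r: "r1 > 0" "r2 > 0"
    and s: "\<And>w. (\<forall>i. norm (w $ i) < r1) \<Longrightarrow> ((\<lambda>\<alpha>. c \<alpha> * mpow w \<alpha>) has_sum f w) UNIV"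
      "\<And>w. (\<forall>i. norm (w $ i) < r2) \<Longrightarrow> ((\<lambda>\<alpha>. d \<alpha> * mpow w \<alpha>) has_sum g w) UNIV"
    using assms unfolding has_power_series_w_def by auto
  show ?thesis
    unfolding has_power_series_w_def
    using r by (intro exI[of _ "min r1 r2"]) (auto simp: ring_distribs intro!: has_sum_add s)
qed

lemma has_power_series_w_cmult:
  assumes "has_power_series_w f 0 c"
  shows "has_power_series_w (\<lambda>w. k * f w) 0 (\<lambda>\<alpha>. k * c \<alpha>)"
proof -
  obtain r where r: "r > 0" "\<And>w. (\<forall>i. norm (w $ i - 0 $ i) < r) \<Longrightarrow> ((\<lambda>\<alpha>. c \<alpha> * mpow (w - 0) \<alpha>) has_sum f w) UNIV"
    using assms unfolding has_power_series_w_def by blast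
  show ?thesis
    unfolding has_power_series_w_def mult.assoc
    by (intro exI[of _ r] conjI allI impI r(1) has_sum_cmult_right r(2)) blast
qed

lemma has_power_series_w_cong:
  fixes f g :: "complex ^ 'm::finite \<Rightarrow> complex"
  assumes "has_power_series_w f 0 c" "open V" "0 \<in> V" "\<And>w. w \<in> V \<Longrightarrow> f w = g w"
  shows "has_power_series_w g 0 c"
proof -
  obtain r1 where r1: "r1 > 0" "\<And>w. (\<forall>i. norm (w $ i - 0 $ i) < r1) \<Longrightarrow> ((\<lambda>\<alpha>. c \<alpha> * mpow (w - 0) \<alpha>) has_sum f w) UNIV"
    using assms(1) unfolding has_power_series_w_def by blast
  obtain r2 where r2: "r2 > 0" "\<And>w. (\<And>i. norm (w $ i - 0 $ i) \<le> r2) \<Longrightarrow> w \<in> V"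
    using closed_box_in_open[OF assms(2,3)] by metis
  show ?thesis
    unfolding has_power_series_w_def
  proof (intro exI[of _ "min r1 r2"] conjI allI impI)
    fix w :: "complex ^ 'm" assume w: "\<forall>i. norm (w $ i - 0 $ i) < min r1 r2"
    then have "w \<in> V" by (intro r2(2)) (auto intro: less_imp_le)
    with r1(2)[of w] w assms(4) show "((\<lambda>\<alpha>. c \<alpha> * mpow (w - 0) \<alpha>) has_sum g w) UNIV" by auto
  qed (use r1 r2 in auto)
qed


section \<open>Holomorphic parameters\<close>

lemma joint_holo_lagrange_fun:
  assumes "open A" "open V" "joint_holo G A V" "joint_holo H A V"
  shows "joint_holo (lagrange_fun1 G H m) A V" "joint_holo (lagrange_fun2 G H m) A V"
  unfolding lagrange_fun1_def[abs_def] lagrange_fun2_def[abs_def]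
  by (intro joint_holo_mult joint_holo_diff joint_holo_power joint_holo_fst joint_holo_deriv assms)+

text \<open>Locally \<open>H(\<phi>(w), w)\<close> is the uniform limit of the partial sums of the Lagrange series, whose terms
  are Taylor coefficients of jointly holomorphic functions.\<close>

lemma sep_holo_lagrange:
  fixes V :: "(complex ^ 'm::finite) set"
  assumes hyps: "lagrange_hyps \<rho> (top_of_set V) G H" and \<rho>: "\<rho> > 0" and V: "open V"
    and G: "joint_holo G (ball 0 \<rho>) V" and H: "joint_holo H (ball 0 \<rho>) V"
  shows "sep_holo (\<lambda>w. H (fixpt \<rho> G w) w) V"
proof (rule sep_holo_local)
  define t where "t k w = coeff_z (Suc k) (\<lambda>\<zeta>. lagrange_fun2 G H (Suc k) \<zeta> w)" for k w
  have t_holo: "sep_holo (t k) V" for k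
    using sep_holo_coeff_z[OF joint_holo_lagrange_fun(2)[OF open_ball V G H] open_ball V] \<rho> by (simp add: t_def[abs_def])
  fix w0 assume "w0 \<in> V"
  then have "w0 \<in> topspace (top_of_set V)" by simp
  from lagrange_terms_locally_geometric[OF hyps \<rho> this] obtain U q C
    where U: "openin (top_of_set V) U" "w0 \<in> U" and q: "0 \<le> q" "q < 1"
    and bd: "\<And>k w. w \<in> U \<Longrightarrow> norm (t k w) \<le> C * q ^ k"
    unfolding t_def by metis
  have U': "open U" "U \<subseteq> V" using U V by (auto simp: openin_open_eq)
  have "sep_holo (\<lambda>w. \<Sum>k. t k w) U"
  proof (rule sep_holo_uniform_limit[OF U'(1)])
    show "uniform_limit U (\<lambda>n w. \<Sum>k<n. t k w) (\<lambda>w. \<Sum>k. t k w) sequentially"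
      by (rule Weierstrass_m_test[OF bd]) (use q in \<open>auto intro!: summable_mult summable_geometric\<close>)
    show "sep_holo (\<lambda>w. \<Sum>k<n. t k w) U" for n
      by (intro sep_holo_sum sep_holo_subset[OF t_holo U'(2)])
  qed auto
  moreover have "sep_holo (H 0) U"
    using H \<rho> U'(2) by (auto simp: joint_holo_def intro: sep_holo_subset)
  ultimately have "sep_holo (\<lambda>w. H 0 w + (\<Sum>k. t k w)) U"
    by (intro sep_holo_add)
  then have "sep_holo (\<lambda>w. H (fixpt \<rho> G w) w) U"
  proof (rule sep_holo_cong[OF U'(1)])
    fix w assume "w \<in> U"
    then have "(\<lambda>k. t k w) sums (H (fixpt \<rho> G w) w - H 0 w)"
      unfolding t_def using U'(2) by (intro lagrange_series_at[OF hyps \<rho>]) auto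
    from sums_unique[OF this] show "H 0 w + (\<Sum>k. t k w) = H (fixpt \<rho> G w) w" by (simp add: diff_eq_eq add.commute)
  qed
  with U U' show "\<exists>U. open U \<and> w0 \<in> U \<and> sep_holo (\<lambda>w. H (fixpt \<rho> G w) w) U" by blast
qed

text \<open>The choice \<open>H(z, w) = z\<close>, for which \<open>H(\<phi>(w), w)\<close> is \<open>\<phi>(w)\<close> itself.\<close>

lemma lagrange_hyps_id:
  assumes "lagrange_hyps \<rho> T G H"
  shows "lagrange_hyps \<rho> T G (\<lambda>z w. z)"
proof -
  have "continuous_map (prod_topology (top_of_set (cball 0 \<rho>)) T) euclidean (\<lambda>(z, w). z)"
    using continuous_map_into_fulltopology[OF continuous_map_fst] by (simp add: case_prod_unfold)
  with assms show ?thesis unfolding lagrange_hyps_def Let_def by (auto simp: analytic_on_ident)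
qed

lemma analytic_w_on_fixpt:
  fixes V :: "(complex ^ 'm::finite) set"
  assumes "lagrange_hyps \<rho> (top_of_set V) G H" and "\<rho> > 0" and "open V" "analytic_zw_on G (ball 0 \<rho> \<times> V)"
  shows "analytic_w_on (fixpt \<rho> G) V"
  using sep_holo_lagrange[OF lagrange_hyps_id[OF assms(1)] assms(2,3) analytic_zw_on_imp_joint_holo[OF assms(4)] joint_holo_fst]
  by (intro sep_holo_imp_analytic_w_on assms(3)) simp

text \<open>Every point \<open>v\<close> of a complete Reinhardt domain lies in an open polydisc about 0 whose closure is
  contained in the domain, because \<open>v\<close> can be pushed outwards a little in all coordinates at once.
  The expansion on this polydisc agrees with the given one near 0, hence has the same coefficients.\<close>

lemma reinhardt_expansion:
  fixes V :: "(complex ^ 'm::finite) set"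
  assumes V: "complete_reinhardt_domain V" and f: "sep_holo f V" and c: "has_power_series_w f 0 c" and v: "v \<in> V"
  obtains R B where "v \<in> polydisc R" "\<And>\<alpha>. norm (c \<alpha>) \<le> B / (\<Prod>i\<in>UNIV. R i ^ \<alpha> i)"
    "\<And>w. w \<in> polydisc R \<Longrightarrow> w \<in> V \<and> ((\<lambda>\<alpha>. c \<alpha> * mpow w \<alpha>) has_sum f w) UNIV"
proof -
  have oV: "open V" using V by (simp add: complete_reinhardt_domain_def)
  obtain e where e: "e > 0" "\<And>w. (\<And>i. norm (w $ i - v $ i) \<le> e) \<Longrightarrow> w \<in> V"
    using closed_box_in_open[OF oV v] by metis
  define R where "R i = norm (v $ i) + e" for i
  have R: "R i > 0" for i using e(1) by (simp add: R_def add_nonneg_pos)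
  \<comment> \<open>Each coordinate is lengthened by \<open>e\<close> in its own direction, or moved to \<open>e\<close> if it is zero, so
    that \<open>v'\<close> is within \<open>e\<close> of \<open>v\<close> in every coordinate and has moduli \<open>R\<close>.\<close>
  define v' where "v' = (\<chi> i. v $ i + of_real e * (if v $ i = 0 then 1 else sgn (v $ i)))"
  have v': "v' \<in> V"
    using e by (intro e(2)) (auto simp: v'_def norm_mult norm_sgn)
  have nv': "norm (v' $ i) = R i" for i
  proof (cases "v $ i = 0")
    case False
    have "v' $ i = of_real (norm (v $ i) + e) * sgn (v $ i)"
      using False by (simp add: v'_def sgn_div_norm scaleR_conv_of_real field_simps)
    then show ?thesis using False e(1) R[of i] by (simp add: norm_mult norm_sgn R_def del: of_real_add)
  qed (use e in \<open>auto simp: v'_def R_def\<close>)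
  let ?K = "{w :: complex ^ 'm. \<forall>i. norm (w $ i) \<le> R i}"
  have K: "?K \<subseteq> V"
    using V v' nv' unfolding complete_reinhardt_domain_def by auto
  have sub: "polydisc R \<subseteq> ?K" by (auto simp: polydisc_def less_imp_le)
  obtain B where B: "\<forall>w\<in>?K. norm (f w) \<le> B"
    by (rule bounded_on_compact[OF continuous_on_subset[OF sep_holo_continuous[OF f] K] compact_closed_polydisc])
  obtain d where d: "\<And>\<alpha>. norm (d \<alpha>) \<le> B / (\<Prod>i\<in>UNIV. R i ^ \<alpha> i)"
      "\<And>w. w \<in> polydisc R \<Longrightarrow> ((\<lambda>\<alpha>. d \<alpha> * mpow w \<alpha>) has_sum f w) UNIV"
    by (rule polydisc_power_series[OF R sep_holo_subset[OF f subset_trans[OF sub K]]]) (use B sub in auto)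
  have "has_power_series_w f 0 d"
    unfolding has_power_series_w_def
  proof (intro exI[of _ e] conjI allI impI)
    fix w :: "complex ^ 'm" assume "\<forall>i. norm (w $ i - 0 $ i) < e"
    then have "w \<in> polydisc R" by (auto simp: polydisc_def R_def intro: less_le_trans)
    from d(2)[OF this] show "((\<lambda>\<alpha>. d \<alpha> * mpow (w - 0) \<alpha>) has_sum f w) UNIV" by simp
  qed (use e in auto)
  with c have "d = c" by (metis has_power_series_w_unique)
  show thesis
  proof (rule that[of R B])
    show "v \<in> polydisc R" using e by (auto simp: polydisc_def R_def)
    show "norm (c \<alpha>) \<le> B / (\<Prod>i\<in>UNIV. R i ^ \<alpha> i)" for \<alpha> using d(1)[of \<alpha>] \<open>d = c\<close> by simp
    show "w \<in> V \<and> ((\<lambda>\<alpha>. c \<alpha> * mpow w \<alpha>) has_sum f w) UNIV" if "w \<in> polydisc R" for w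
      using d(2)[OF that] \<open>d = c\<close> that sub K by auto
  qed
qed

text \<open>On a polydisc slightly smaller than the one of \<open>reinhardt_expansion\<close> the series is dominated by
  its absolute values at a point with positive coordinates. Finitely many of these smaller
  polydiscs cover a compact set.\<close>

lemma reinhardt_unif_abs_sums:
  fixes V :: "(complex ^ 'm::finite) set"
  assumes V: "complete_reinhardt_domain V" and f: "sep_holo f V" and c: "has_power_series_w f 0 c"
  shows "unif_abs_sums_on_compacts V (\<lambda>\<alpha> w. c \<alpha> * mpow w \<alpha>) f"
proof -
  have loc: "((\<lambda>\<alpha>. norm (c \<alpha> * mpow v \<alpha>)) summable_on UNIV \<and> ((\<lambda>\<alpha>. c \<alpha> * mpow v \<alpha>) has_sum f v) UNIV) \<and>
     (\<exists>W. open W \<and> v \<in> W \<and>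
        uniform_limit W (\<lambda>F w. \<Sum>\<alpha>\<in>F. norm (c \<alpha> * mpow w \<alpha>)) (\<lambda>w. \<Sum>\<^sub>\<infinity>\<alpha>. norm (c \<alpha> * mpow w \<alpha>)) (finite_subsets_at_top UNIV) \<and>
        uniform_limit W (\<lambda>F w. \<Sum>\<alpha>\<in>F. c \<alpha> * mpow w \<alpha>) f (finite_subsets_at_top UNIV))" if v: "v \<in> V" for v
  proof -
    obtain R B where R: "v \<in> polydisc R" and bd: "\<And>\<alpha>. norm (c \<alpha>) \<le> B / (\<Prod>i\<in>UNIV. R i ^ \<alpha> i)"
      and sums: "\<And>w. w \<in> polydisc R \<Longrightarrow> w \<in> V \<and> ((\<lambda>\<alpha>. c \<alpha> * mpow w \<alpha>) has_sum f w) UNIV"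
      by (rule reinhardt_expansion[OF assms v]) blast
    have sm: "(\<lambda>\<alpha>. norm (c \<alpha> * mpow w \<alpha>)) summable_on UNIV" if "w \<in> polydisc R" for w
      by (rule power_terms_norm_summable[OF that bd])
    define R' where "R' i = (norm (v $ i) + R i) / 2" for i
    have R': "norm (v $ i) < R' i" "R' i < R i" "0 < R' i" for i
    proof -
      have "norm (v $ i) < R i" using R by (simp add: polydisc_def)
      then show v: "norm (v $ i) < R' i" and "R' i < R i" by (auto simp: R'_def)
      show "0 < R' i" by (rule le_less_trans[OF norm_ge_zero v])
    qed
    let ?u = "(\<chi> i. of_real (R' i)) :: complex ^ 'm"
    have u: "?u \<in> polydisc R" using R' by (auto simp: polydisc_def less_imp_le)
    have le: "norm (c \<alpha> * mpow w \<alpha>) \<le> norm (c \<alpha> * mpow ?u \<alpha>)" if "w \<in> polydisc R'" for w \<alpha>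
      unfolding norm_mult norm_mpow using that R'
      by (intro mult_left_mono prod_mono conjI power_mono) (auto simp: polydisc_def less_imp_le)
    have subR: "polydisc R' \<subseteq> polydisc R" using R' by (force simp: polydisc_def intro: less_trans)
    have "uniform_limit (polydisc R') (\<lambda>F w. \<Sum>\<alpha>\<in>F. norm (c \<alpha> * mpow w \<alpha>)) (\<lambda>w. \<Sum>\<^sub>\<infinity>\<alpha>. norm (c \<alpha> * mpow w \<alpha>)) (finite_subsets_at_top UNIV)"
      by (rule Weierstrass_m_test_general'[OF _ _ sm[OF u]])
        (use le subR sm in \<open>auto intro!: has_sum_infsum\<close>)
    moreover have "uniform_limit (polydisc R') (\<lambda>F w. \<Sum>\<alpha>\<in>F. c \<alpha> * mpow w \<alpha>) f (finite_subsets_at_top UNIV)"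
      by (rule Weierstrass_m_test_general'[OF _ _ sm[OF u]])
        (use le subR sums in auto)
    moreover have "v \<in> polydisc R'" using R' by (auto simp: polydisc_def)
    ultimately show ?thesis
      using sm[OF R] sums[OF R] open_polydisc[of R'] by blast
  qed
  show ?thesis
    unfolding unif_abs_sums_on_compacts_def
  proof (intro conjI ballI allI impI)
    fix K assume K: "compact K \<and> K \<subseteq> V"
    have "\<forall>v\<in>K. \<exists>W. open W \<and> v \<in> W \<and>
        uniform_limit W (\<lambda>F w. \<Sum>\<alpha>\<in>F. norm (c \<alpha> * mpow w \<alpha>)) (\<lambda>w. \<Sum>\<^sub>\<infinity>\<alpha>. norm (c \<alpha> * mpow w \<alpha>)) (finite_subsets_at_top UNIV) \<and>
        uniform_limit W (\<lambda>F w. \<Sum>\<alpha>\<in>F. c \<alpha> * mpow w \<alpha>) f (finite_subsets_at_top UNIV)"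
      using loc K by blast
    from bchoice[OF this] obtain W where W: "\<And>v. v \<in> K \<Longrightarrow> open (W v)" "\<And>v. v \<in> K \<Longrightarrow> v \<in> W v"
        "\<And>v. v \<in> K \<Longrightarrow> uniform_limit (W v) (\<lambda>F w. \<Sum>\<alpha>\<in>F. norm (c \<alpha> * mpow w \<alpha>)) (\<lambda>w. \<Sum>\<^sub>\<infinity>\<alpha>. norm (c \<alpha> * mpow w \<alpha>)) (finite_subsets_at_top UNIV)"
        "\<And>v. v \<in> K \<Longrightarrow> uniform_limit (W v) (\<lambda>F w. \<Sum>\<alpha>\<in>F. c \<alpha> * mpow w \<alpha>) f (finite_subsets_at_top UNIV)"
      by auto
    obtain K' where K': "K' \<subseteq> K" "finite K'" "K \<subseteq> (\<Union>v\<in>K'. W v)"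
      by (rule compactE_image[of K K W]) (use K W(1,2) in auto)
    show "uniform_limit K (\<lambda>F w. \<Sum>\<alpha>\<in>F. norm (c \<alpha> * mpow w \<alpha>)) (\<lambda>w. \<Sum>\<^sub>\<infinity>\<alpha>. norm (c \<alpha> * mpow w \<alpha>)) (finite_subsets_at_top UNIV)"
      by (rule uniform_limit_on_subset[OF uniform_limit_on_UNION K'(3)]) (use K' W in auto)
    show "uniform_limit K (\<lambda>F w. \<Sum>\<alpha>\<in>F. c \<alpha> * mpow w \<alpha>) f (finite_subsets_at_top UNIV)"
      by (rule uniform_limit_on_subset[OF uniform_limit_on_UNION K'(3)]) (use K' W in auto)
  qed (use loc in blast)+
qed

text \<open>Cauchy's inequalities bound the coefficient of \<open>w\<^sup>\<alpha>\<close> in \<open>t k\<close> by \<open>C q\<^sup>k / r\<^bsup>|\<alpha>|\<^esup>\<close>. For \<open>w\<close> in the polydisc the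
  double series over \<open>k\<close> and \<open>\<alpha>\<close> is therefore absolutely convergent, and summing over \<open>k\<close> first gives the
  coefficients of the sum.\<close>

lemma has_power_series_w_geometric_sum:
  fixes t :: "nat \<Rightarrow> complex ^ 'm::finite \<Rightarrow> complex"
  assumes r: "r > 0" and q: "0 \<le> q" "q < 1"
    and holo: "\<And>k. sep_holo (t k) (polydisc (\<lambda>_. r))"
    and bd: "\<And>k w. w \<in> polydisc (\<lambda>_. r) \<Longrightarrow> norm (t k w) \<le> C * q ^ k"
    and a: "\<And>k. has_power_series_w (t k) 0 (a k)"
  shows "summable (\<lambda>k. norm (a k \<alpha>))" "has_power_series_w (\<lambda>w. \<Sum>k. t k w) 0 (\<lambda>\<alpha>. \<Sum>k. a k \<alpha>)"
proof -
  have 0: "0 \<in> polydisc (\<lambda>_::'m. r)" using r by (auto simp: polydisc_def)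
  have C: "C \<ge> 0" using order_trans[OF norm_ge_zero bd[OF 0, of 0]] by simp
  have a_prop: "(\<forall>\<alpha>. norm (a k \<alpha>) \<le> C * q ^ k / (\<Prod>i\<in>(UNIV::'m set). r ^ \<alpha> i)) \<and>
     (\<forall>w\<in>polydisc (\<lambda>_. r). ((\<lambda>\<alpha>. a k \<alpha> * mpow w \<alpha>) has_sum t k w) UNIV)" for k
  proof -
    obtain d where d: "\<And>\<alpha>. norm (d \<alpha>) \<le> C * q ^ k / (\<Prod>i\<in>(UNIV::'m set). r ^ \<alpha> i)"
        "\<And>w. w \<in> polydisc (\<lambda>_. r) \<Longrightarrow> ((\<lambda>\<alpha>. d \<alpha> * mpow w \<alpha>) has_sum t k w) UNIV"
      by (rule polydisc_power_series[of "\<lambda>_. r" "t k" "C * q ^ k"]) (use r holo bd in auto)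
    have "has_power_series_w (t k) 0 d"
      unfolding has_power_series_w_def
      using r d(2) by (intro exI[of _ r]) (auto simp: polydisc_def)
    then have "d = a k" using a has_power_series_w_unique by metis
    with d show ?thesis by blast
  qed
  have sma: "summable (\<lambda>k. norm (a k \<alpha>))" for \<alpha>
  proof (rule summable_comparison_test')
    show "summable (\<lambda>k. C / (\<Prod>i\<in>(UNIV::'m set). r ^ \<alpha> i) * q ^ k)"
      using q by (intro summable_mult summable_geometric) auto
    show "norm (norm (a k \<alpha>)) \<le> C / (\<Prod>i\<in>(UNIV::'m set). r ^ \<alpha> i) * q ^ k" for k
      using a_prop[of k] by simp
  qed
  then show "summable (\<lambda>k. norm (a k \<alpha>))" .
  show "has_power_series_w (\<lambda>w. \<Sum>k. t k w) 0 (\<lambda>\<alpha>. \<Sum>k. a k \<alpha>)"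
    unfolding has_power_series_w_def
  proof (intro exI[of _ r] conjI allI impI)
    fix w :: "complex ^ 'm" assume "\<forall>i. norm (w $ i - 0 $ i) < r"
    then have w: "w \<in> polydisc (\<lambda>_. r)" by (auto simp: polydisc_def)
    have "(\<lambda>\<alpha>. \<Prod>i\<in>UNIV. (norm (w $ i) / r) ^ \<alpha> i) summable_on UNIV"
      using w r by (intro multi_geometric_summable) (auto simp: polydisc_def)
    moreover have "(\<lambda>k. C * q ^ k) summable_on UNIV"
      using q by (intro summable_on_cmult_right summable_nonneg_imp_summable_on summable_geometric) auto
    ultimately have "(\<lambda>(k, \<alpha>). (C * q ^ k) * (\<Prod>i\<in>UNIV. (norm (w $ i) / r) ^ \<alpha> i)) summable_on UNIV \<times> UNIV"
      using q C r by (intro summable_on_times_nonneg) (auto intro!: prod_nonneg)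
    then have "(\<lambda>p. norm (case p of (k, \<alpha>) \<Rightarrow> a k \<alpha> * mpow w \<alpha>)) summable_on UNIV \<times> UNIV"
    proof (rule summable_on_comparison_test)
      fix p :: "nat \<times> ('m \<Rightarrow> nat)"
      obtain k \<alpha> where [simp]: "p = (k, \<alpha>)" by (cases p)
      have "norm (a k \<alpha> * mpow w \<alpha>) \<le> C * q ^ k / (\<Prod>i\<in>(UNIV::'m set). r ^ \<alpha> i) * (\<Prod>i\<in>UNIV. norm (w $ i) ^ \<alpha> i)"
        unfolding norm_mult norm_mpow using a_prop[of k] by (intro mult_right_mono prod_nonneg) auto
      also have "\<dots> = (C * q ^ k) * (\<Prod>i\<in>UNIV. (norm (w $ i) / r) ^ \<alpha> i)"
        by (simp add: power_divide prod_dividef)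
      finally show "norm (case p of (k, \<alpha>) \<Rightarrow> a k \<alpha> * mpow w \<alpha>) \<le>
          (case p of (k, \<alpha>) \<Rightarrow> (C * q ^ k) * (\<Prod>i\<in>UNIV. (norm (w $ i) / r) ^ \<alpha> i))" by simp
    qed auto
    then have sm: "(\<lambda>(k, \<alpha>). a k \<alpha> * mpow w \<alpha>) summable_on UNIV \<times> UNIV"
      by (rule abs_summable_summable)
    have smt: "summable (\<lambda>k. norm (t k w))"
      by (rule summable_comparison_test'[of "\<lambda>k. C * q ^ k"])
        (use q bd[OF w] in \<open>auto intro!: summable_mult summable_geometric\<close>)
    have "((\<lambda>k. t k w) has_sum (\<Sum>k. t k w)) UNIV"
      by (rule norm_summable_imp_has_sum[OF smt summable_sums[OF summable_norm_cancel[OF smt]]])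
    then have "((\<lambda>(k, \<alpha>). a k \<alpha> * mpow w \<alpha>) has_sum (\<Sum>k. t k w)) (UNIV \<times> UNIV)"
      by (rule has_sum_SigmaI[rotated]) (use sm a_prop w in auto)
    then have "((\<lambda>(\<alpha>, k). a k \<alpha> * mpow w \<alpha>) has_sum (\<Sum>k. t k w)) (UNIV \<times> UNIV)"
      by (rule iffD1[OF has_sum_reindex_bij_witness[of _ prod.swap prod.swap], rotated -1]) auto
    then have "((\<lambda>\<alpha>. (\<Sum>k. a k \<alpha>) * mpow w \<alpha>) has_sum (\<Sum>k. t k w)) UNIV"
    proof (rule has_sum_SigmaD)
      fix \<alpha>
      have "((\<lambda>k. a k \<alpha>) has_sum (\<Sum>k. a k \<alpha>)) UNIV"
        by (rule norm_summable_imp_has_sum[OF sma summable_sums[OF summable_norm_cancel[OF sma]]])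
      from has_sum_cmult_left[OF this]
      show "((\<lambda>k. case (\<alpha>, k) of (\<alpha>, k) \<Rightarrow> a k \<alpha> * mpow w \<alpha>) has_sum (\<Sum>k. a k \<alpha>) * mpow w \<alpha>) UNIV" by simp
    qed
    then show "((\<lambda>\<alpha>. (\<Sum>k. a k \<alpha>) * mpow (w - 0) \<alpha>) has_sum (\<Sum>k. t k w)) UNIV" by simp
  qed (use r in auto)
qed

text \<open>Near 0 the Taylor coefficients of \<open>H(\<phi>(w), w)\<close> are obtained by summing those of the Lagrange terms;
  the result is then transported to the whole Reinhardt domain. The two forms of the coefficients
  agree because the terms agree as functions of \<open>w\<close>.\<close>

lemma lagrange_taylor_series:
  fixes V :: "(complex ^ 'm::finite) set"
  assumes hyps: "lagrange_hyps \<rho> (top_of_set V) G H" and \<rho>: "\<rho> > 0" and V: "complete_reinhardt_domain V"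
    and G: "analytic_zw_on G (ball 0 \<rho> \<times> V)" and H: "analytic_zw_on H (ball 0 \<rho> \<times> V)"
  defines "t1 \<equiv> \<lambda>m \<alpha>. 1 / of_nat m * coeff_zw (m - 1) \<alpha> (lagrange_fun1 G H m)"
    and "t2 \<equiv> \<lambda>m \<alpha>. coeff_zw m \<alpha> (lagrange_fun2 G H m)"
  shows "\<exists>c. (\<forall>\<alpha>. summable (\<lambda>k. norm (t1 (Suc k) \<alpha>)) \<and> summable (\<lambda>k. norm (t2 (Suc k) \<alpha>)) \<and>
                   c \<alpha> = coeff_w \<alpha> (\<lambda>w. H 0 w) + (\<Sum>k. t1 (Suc k) \<alpha>) \<and>
                   c \<alpha> = coeff_w \<alpha> (\<lambda>w. H 0 w) + (\<Sum>k. t2 (Suc k) \<alpha>)) \<and>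
                 unif_abs_sums_on_compacts V (\<lambda>\<alpha> w. c \<alpha> * mpow w \<alpha>) (\<lambda>w. H (fixpt \<rho> G w) w)"
proof -
  have oV: "open V" and V0: "0 \<in> V"
    using V by (auto simp: complete_reinhardt_domain_def)
  have jG: "joint_holo G (ball 0 \<rho>) V" and jH: "joint_holo H (ball 0 \<rho>) V"
    using G H by (auto intro: analytic_zw_on_imp_joint_holo)
  have b0: "(0::complex) \<in> ball 0 \<rho>" using \<rho> by simp
  note jL = joint_holo_lagrange_fun[OF open_ball oV jG jH]
  define t where "t k w = coeff_z (Suc k) (\<lambda>\<zeta>. lagrange_fun2 G H (Suc k) \<zeta> w)" for k w
  obtain c2 where c2: "\<And>m. has_power_series_zw (lagrange_fun2 G H m) 0 0 (c2 m)"
    using joint_holo_has_power_series_zw[OF jL(2) open_ball b0 oV V0] by metis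
  obtain c1 where c1: "\<And>m. has_power_series_zw (lagrange_fun1 G H m) 0 0 (c1 m)"
    using joint_holo_has_power_series_zw[OF jL(1) open_ball b0 oV V0] by metis
  define a where "a k = c2 (Suc k) (Suc k)" for k
  have a: "has_power_series_w (t k) 0 (a k)" for k
    using has_power_series_zw_slice[OF c2] by (simp add: t_def[abs_def] a_def)
  have t2: "t2 (Suc k) \<alpha> = a k \<alpha>" for k \<alpha>
    unfolding t2_def coeff_zw_eq_coeff_w[OF c2] by (rule coeff_w_eqI) (use a in \<open>simp add: t_def[abs_def]\<close>)
  have t1: "t1 (Suc k) \<alpha> = a k \<alpha>" for k \<alpha>
  proof -
    have s1: "has_power_series_w (\<lambda>w. coeff_z k (\<lambda>\<zeta>. lagrange_fun1 G H (Suc k) \<zeta> w)) 0 (c1 (Suc k) k)"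
      by (rule has_power_series_zw_slice[OF c1])
    have "has_power_series_w (t k) 0 (\<lambda>\<alpha>. 1 / of_nat (Suc k) * c1 (Suc k) k \<alpha>)"
      by (rule has_power_series_w_cong[OF has_power_series_w_cmult[OF s1, of "1 / of_nat (Suc k)"] oV V0])
        (unfold t_def, rule lagrange_terms_eq_on_topspace[OF hyps \<rho>], simp)
    with a have "a k = (\<lambda>\<alpha>. 1 / of_nat (Suc k) * c1 (Suc k) k \<alpha>)" by (metis has_power_series_w_unique)
    then show ?thesis
      unfolding t1_def coeff_zw_eq_coeff_w[OF c1] diff_Suc_1 coeff_w_eqI[OF s1] by simp
  qed
  have t_holo: "sep_holo (t k) V" for k
    using sep_holo_coeff_z[OF jL(2) open_ball oV b0] by (simp add: t_def[abs_def])
  have "0 \<in> topspace (top_of_set V)" using V0 by simp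
  from lagrange_terms_locally_geometric[OF hyps \<rho> this] obtain U q C
    where U: "openin (top_of_set V) U" "0 \<in> U" and q: "0 \<le> q" "q < 1"
    and bd: "\<And>k w. w \<in> U \<Longrightarrow> norm (t k w) \<le> C * q ^ k"
    unfolding t_def by metis
  have U': "open U" "U \<subseteq> V" using U oV by (auto simp: openin_open_eq)
  obtain r where r: "r > 0" "\<And>w. (\<And>i. norm (w $ i - 0 $ i) \<le> r) \<Longrightarrow> w \<in> U"
    using closed_box_in_open[OF U'(1) U(2)] by metis
  have pU: "polydisc (\<lambda>_. r) \<subseteq> U" using r(2) by (auto simp: polydisc_def less_imp_le)
  note geo = has_power_series_w_geometric_sum[OF r(1) q sep_holo_subset[OF t_holo subset_trans[OF pU U'(2)]] bd[OF subsetD[OF pU]] a]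
  have "analytic_w_on (H 0) V"
    using jH b0 by (intro sep_holo_imp_analytic_w_on oV) (auto simp: joint_holo_def)
  then obtain h where h: "has_power_series_w (H 0) 0 h" using V0 unfolding analytic_w_on_def by blast
  have hc: "coeff_w \<alpha> (\<lambda>w. H 0 w) = h \<alpha>" for \<alpha> using coeff_w_eqI[OF h] by simp
  define c where "c \<alpha> = h \<alpha> + (\<Sum>k. a k \<alpha>)" for \<alpha>
  have "has_power_series_w (\<lambda>w. H (fixpt \<rho> G w) w) 0 c"
    unfolding c_def
  proof (rule has_power_series_w_cong[OF has_power_series_w_add[OF h geo(2)] oV V0])
    fix w assume "w \<in> V"
    then have "(\<lambda>k. t k w) sums (H (fixpt \<rho> G w) w - H 0 w)"
      unfolding t_def by (intro lagrange_series_at[OF hyps \<rho>]) simp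
    from sums_unique[OF this] show "H 0 w + (\<Sum>k. t k w) = H (fixpt \<rho> G w) w" by (simp add: diff_eq_eq add.commute)
  qed
  from reinhardt_unif_abs_sums[OF V sep_holo_lagrange[OF hyps \<rho> oV jG jH] this]
  show ?thesis
    using geo(1) by (intro exI[of _ c]) (auto simp: t1 t2 c_def hc)
qed

theorem theorem2p3:
  fixes \<rho> :: real
  assumes "\<rho> > 0"
  shows
    "(\<forall>(T :: 'v topology) G H. lagrange_hyps \<rho> T G H \<longrightarrow>
        (\<forall>w\<in>topspace T. \<exists>!z. z \<in> ball 0 \<rho> \<and> z = G z w) \<and>
        continuous_map T euclidean (fixpt \<rho> G) \<and>
        (let t1 = (\<lambda>m w. 1 / of_nat m * coeff_z (m - 1) (\<lambda>\<zeta>. lagrange_fun1 G H m \<zeta> w));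
             t2 = (\<lambda>m w. coeff_z m (\<lambda>\<zeta>. lagrange_fun2 G H m \<zeta> w))
         in loc_unif_abs_convergent T t1 \<and>
            loc_unif_abs_convergent T t2 \<and>
            (\<forall>w\<in>topspace T.
               H (fixpt \<rho> G w) w = H 0 w + (\<Sum>k. t1 (Suc k) w) \<and>
               H (fixpt \<rho> G w) w = H 0 w + (\<Sum>k. t2 (Suc k) w)))) \<and>
     (\<forall>(V :: (complex ^ 'm::finite) set) G H. lagrange_hyps \<rho> (top_of_set V) G H \<longrightarrow>
        (open V \<and> analytic_zw_on G (ball 0 \<rho> \<times> V) \<longrightarrow> analytic_w_on (fixpt \<rho> G) V) \<and>
        (complete_reinhardt_domain V \<and>
         analytic_zw_on G (ball 0 \<rho> \<times> V) \<and> analytic_zw_on H (ball 0 \<rho> \<times> V) \<and> G 0 0 = 0 \<longrightarrow>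
           (let t1 = (\<lambda>m \<alpha>. 1 / of_nat m * coeff_zw (m - 1) \<alpha> (lagrange_fun1 G H m));
                t2 = (\<lambda>m \<alpha>. coeff_zw m \<alpha> (lagrange_fun2 G H m))
            in \<exists>c. (\<forall>\<alpha>.
                   summable (\<lambda>k. norm (t1 (Suc k) \<alpha>)) \<and>
                   summable (\<lambda>k. norm (t2 (Suc k) \<alpha>)) \<and>
                   c \<alpha> = coeff_w \<alpha> (\<lambda>w. H 0 w) + (\<Sum>k. t1 (Suc k) \<alpha>) \<and>
                   c \<alpha> = coeff_w \<alpha> (\<lambda>w. H 0 w) + (\<Sum>k. t2 (Suc k) \<alpha>)) \<and>
                 unif_abs_sums_on_compacts V (\<lambda>\<alpha> w. c \<alpha> * mpow w \<alpha>)
                   (\<lambda>w. H (fixpt \<rho> G w) w))))"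
proof (intro conjI allI impI, goal_cases)
  case (1 T G H)
  from lagrange_inversion_continuous[OF assms 1] show ?case by (rule conjunct1)
next
  case (2 T G H)
  from lagrange_inversion_continuous[OF assms 2] show ?case by (rule conjunct1[OF conjunct2])
next
  case (3 T G H)
  from lagrange_inversion_continuous[OF assms 3] show ?case by (rule conjunct2[OF conjunct2])
next
  case (4 V G H)
  then show ?case by (intro analytic_w_on_fixpt[OF _ assms]) auto
next
  case (5 V G H)
  then show ?case unfolding Let_def by (intro lagrange_taylor_series[OF _ assms]) auto
qed

end
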